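(* Let $n\geq 2$, let $\Omega\subset\mathbb{R}^n$ be a domain and let $0<\lambda\leq\Lambda<\infty$ satisfy $$1\leq\frac{\Lambda}{\lambda}<\frac{n+1}{n-1}.$$ Let $A:\Omega\to\mathcal{A}(\lambda,\Lambda)$ be a measurable mapping with constant determinant, and suppose that $B_{2r}(x_0)\subset\Omega$ for some $r>0$. Let $\varepsilon>0$ and let $u_\varepsilon$ be a solution to the dynamic programming principle $$u_\varepsilon(x)=\frac{1}{|E_x|}\int_{E_x}u_\varepsilon(y)\,dy\qquad\text{for every }x\in\Omega,$$ with $u_\varepsilon$ bounded on $B_{2r}(x_0)$. Then there exist an exponent $\alpha=\alpha(n,\lambda,\Lambda)\in(0,1)$ and a constant $C>0$, depending on $n,\lambda,\Lambda,r,\alpha$ and $\sup_{B_{2r}(x_0)}|u_\varepsilon|$ but independent of $\varepsilon$, such that $$|u_\varepsilon(x)-u_\varepsilon(z)|\leq C\big(|x-z|^\alpha+\varepsilon^\alpha\big)$$ for every $x,z\in B_r(x_0)$.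
   Context: $\mathbb{B}$ denotes the open unit ball of $\mathbb{R}^n$ and $B_\rho(x)$ the open ball of radius $\rho$ centered at $x$. $\mathcal{A}(\lambda,\Lambda)$ is the set of all symmetric $n\times n$ real matrices $A$ with $\lambda|\xi|^2\leq\xi^\top A\,\xi\leq\Lambda|\xi|^2$ for every $\xi\in\mathbb{R}^n$. For $A\in\mathcal{A}(\lambda,\Lambda)$, $A^{1/2}$ is the principal (symmetric positive definite) square root. For $x\in\Omega$, the ellipsoid $E_x$ is $$E_x=E_{\varepsilon,A,x}:=x+\varepsilon A(x)^{1/2}\mathbb{B}.$$ "Constant determinant" means $\det A(x)$ is the same for all $x\in\Omega$ (so all $E_x$ have the same measure). The function $u_\varepsilon$ is real-valued, measurable, defined on a set containing $\Omega$ and all the ellipsoids $E_x$, $x\in\Omega$, and integrable on each $E_x$, so that the dynamic programming principle makes sense. The exponent $\alpha$ depends only on $n,\lambda,\Lambda$, and $C$ depends only on the quantities listed (not on $\varepsilon$). *)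

theory Defs
  imports "HOL-Analysis.Analysis"
begin

definition elliptic_matrices :: "real \<Rightarrow> real \<Rightarrow> (real^'n^'n) set" where
  "elliptic_matrices lam Lam =
     {A. transpose A = A \<and>
         (\<forall>\<xi>. lam * (norm \<xi>)\<^sup>2 \<le> \<xi> \<bullet> (A *v \<xi>) \<and> \<xi> \<bullet> (A *v \<xi>) \<le> Lam * (norm \<xi>)\<^sup>2)}"

definition pos_def_matrix :: "real^'n^'n \<Rightarrow> bool" where
  "pos_def_matrix S \<longleftrightarrow> transpose S = S \<and> (\<forall>\<xi>. \<xi> \<noteq> 0 \<longrightarrow> 0 < \<xi> \<bullet> (S *v \<xi>))"

text \<open>The principal square root. The description is meaningful only for a symmetric positive
  definite argument, where such a root exists and is unique.\<close>

definition matrix_sqrt :: "real^'n^'n \<Rightarrow> real^'n^'n" where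
  "matrix_sqrt A = (THE S. pos_def_matrix S \<and> S ** S = A)"

definition ellipsoid :: "real \<Rightarrow> (real^'n \<Rightarrow> real^'n^'n) \<Rightarrow> real^'n \<Rightarrow> (real^'n) set" where
  "ellipsoid \<epsilon> A x = (\<lambda>y. x + \<epsilon> *\<^sub>R (matrix_sqrt (A x) *v y)) ` ball 0 1"

text \<open>The set \<open>D\<close> is the domain of definition of \<open>u\<close>; values of the total function \<open>u\<close>
  outside \<open>D\<close>, and of \<open>A\<close> outside \<open>\<Omega>\<close>, play no role. Measurability is Lebesgue measurability.\<close>

definition dpp_solution ::
  "(real^'n) set \<Rightarrow> (real^'n) set \<Rightarrow> real \<Rightarrow> (real^'n \<Rightarrow> real^'n^'n) \<Rightarrow> (real^'n \<Rightarrow> real) \<Rightarrow> bool" where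
  "dpp_solution D \<Omega> \<epsilon> A u \<longleftrightarrow>
     \<Omega> \<subseteq> D \<and> (\<forall>x\<in>\<Omega>. ellipsoid \<epsilon> A x \<subseteq> D) \<and>
     u \<in> borel_measurable (lebesgue_on D) \<and>
     (\<forall>x\<in>\<Omega>. set_integrable lebesgue (ellipsoid \<epsilon> A x) u) \<and>
     (\<forall>x\<in>\<Omega>. u x = 1 / measure lebesgue (ellipsoid \<epsilon> A x) *
                    (LINT y:ellipsoid \<epsilon> A x|lebesgue. u y))"

end

theory Submission
  imports Defs
begin

text \<open>
  The proof is a coupling argument. Write \<open>S(x) = A(x)\<^sup>1\<^sup>/\<^sup>2\<close>. In coordinates of the unit ball the
  dynamic programming principle says that \<open>u(x)\<close> is the average of \<open>u(x + \<epsilon> S(x) Q y)\<close> over \<open>|y| < 1\<close>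
  for every orthogonal matrix \<open>Q\<close>. Hence \<open>u(x) - u(z)\<close> is an average of differences of \<open>u\<close> at pairs whose
  difference vector is \<open>x - z + \<epsilon> (S(x) - S(z) Q) y\<close>, and \<open>Q\<close> may depend on the pair \<open>(x, z)\<close>. If some
  function \<open>f(x, z)\<close> strictly decreases on average along such a step, a maximum principle for pairs
  gives \<open>u(x) - u(z) \<le> f(x, z)\<close> (lemma \<open>comparison\<close>). Here \<open>f\<close> is a multiple of \<open>|x - z|\<^sup>\<alpha>\<close>, plus
  corrections of size \<open>\<epsilon>\<^sup>\<alpha>\<close>, plus a quadratic term that keeps nearly
  maximising pairs away from the boundary of the ball on which \<open>u\<close> is bounded.

  For large \<open>|x - z| / \<epsilon>\<close> expand \<open>|x - z|\<^sup>\<alpha>\<close> to second order. With \<open>M = S(x) - S(z) Q\<close> and \<open>e\<close> the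
  direction of \<open>x - z\<close>, the average decreases if \<open>tr (M M\<^sup>T) < (2 - \<alpha>) |M\<^sup>T e|\<^sup>2\<close>, that is, if the
  fluctuation along \<open>e\<close>, discounted by \<open>1 - \<alpha>\<close>, exceeds that in all orthogonal directions together. Choosing \<open>Q\<close> as
  the inverse of the orthogonal factor in the polar decomposition of \<open>S(x) J S(z)\<close>, with \<open>J\<close> the
  reflection along \<open>e\<close>, one obtains
  \<open>tr (M M\<^sup>T) - 2 |M\<^sup>T e|\<^sup>2 \<le> 2 ((n - 1) \<Lambda> - (n + 1) \<lambda>)\<close> (theorem \<open>reflection_coupling\<close>). The right-hand side is
  negative exactly under the assumption on \<open>\<Lambda> / \<lambda>\<close>, and this leaves room for a small \<open>\<alpha> > 0\<close>.

  For \<open>|x - z|\<close> comparable to \<open>\<epsilon>\<close> the expansion is useless, but an exponential term in \<open>f\<close> profits from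
  the fixed probability with which the two points approach each other (lemma \<open>near_contraction\<close>).
  For \<open>|x - z|\<close> smaller still, the two ellipsoids overlap in a fixed proportion of their common
  measure; the overlap cancels in \<open>u(x) - u(z)\<close>, and a jump of \<open>f\<close> across the diagonal, of size
  \<open>\<epsilon>\<^sup>\<alpha>\<close>, turns this into a strict decrease (lemma \<open>overlap_estimate\<close>).
\<close>

section \<open>Linear changes of variables for Lebesgue measure\<close>

lemma nn_integral_lborel_shift:
  fixes g :: "'a::euclidean_space \<Rightarrow> ennreal"
  assumes [measurable]: "g \<in> borel_measurable borel"
  shows "(\<integral>\<^sup>+x. g (a + x) \<partial>lborel) = (\<integral>\<^sup>+x. g x \<partial>lborel)"
proof -
  have "(\<integral>\<^sup>+x. g x \<partial>lborel) = (\<integral>\<^sup>+x. g x \<partial>distr lborel borel ((+) a))"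
    by (simp add: lborel_distr_plus)
  also have "\<dots> = (\<integral>\<^sup>+x. g (a + x) \<partial>lborel)"
    by (subst nn_integral_distr) auto
  finally show ?thesis by simp
qed

lemma nn_integral_lborel_reflect:
  fixes g :: "'a::euclidean_space \<Rightarrow> ennreal"
  assumes [measurable]: "g \<in> borel_measurable borel"
  shows "(\<integral>\<^sup>+x. g (- x) \<partial>lborel) = (\<integral>\<^sup>+x. g x \<partial>lborel)"
proof -
  have "(lborel :: 'a measure) = density (distr lborel borel (\<lambda>x. 0 + (-1::real) *\<^sub>R x)) (\<lambda>_. \<bar>-1::real\<bar> ^ DIM('a))"
    by (rule lborel_affine) simp
  then have "(lborel :: 'a measure) = distr lborel borel uminus"
    by (simp add: density_1)
  then have "(\<integral>\<^sup>+x. g x \<partial>lborel) = (\<integral>\<^sup>+x. g x \<partial>distr lborel borel uminus)" by simp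
  also have "\<dots> = (\<integral>\<^sup>+x. g (- x) \<partial>lborel)"
    by (subst nn_integral_distr) auto
  finally show ?thesis by simp
qed

text \<open>
  Translation-invariant measures are proportional, by Tonelli's theorem: the double integral of
  \<open>1\<^sub>A (f x) \<cdot> 1\<^sub>B (f x + y)\<close> equals the left-hand side if the translation by \<open>f x\<close> is removed in the
  variable \<open>y\<close>, and the right-hand side if the order of integration is exchanged and \<open>x\<close> is first
  translated by the preimage of \<open>y\<close>.
\<close>

lemma linear_preimage_cross_ratio:
  fixes f :: "'a::euclidean_space \<Rightarrow> 'a"
  assumes f: "linear f" "bij f" and [measurable]: "A \<in> sets borel" "B \<in> sets borel"
  shows "emeasure lborel (f -` A) * emeasure lborel B = emeasure lborel (f -` B) * emeasure lborel A"
proof -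
  obtain g where g: "linear g" "\<And>x. g (f x) = x" "\<And>x. f (g x) = x"
    using f by (metis bij_def linear_injective_left_inverse linear_surjective_right_inverse comp_apply id_apply bij_is_inj bij_is_surj)
  have [measurable]: "f \<in> borel_measurable borel"
    by (simp add: borel_measurable_continuous_onI f(1) linear_continuous_on linear_linear)
  have vim[measurable]: "f -` X \<in> sets borel" if "X \<in> sets borel" for X
    using measurable_sets[OF \<open>f \<in> borel_measurable borel\<close> that] by simp
  have "emeasure lborel (f -` A) * emeasure lborel B
      = (\<integral>\<^sup>+x. indicator A (f x) * emeasure lborel B \<partial>lborel)"
    by (subst nn_integral_multc) (auto simp: vim[simplified] simp flip: nn_integral_indicator 
        intro!: nn_integral_cong arg_cong2[where f="(*)"] split: split_indicator)
  also have "\<dots> = (\<integral>\<^sup>+x. (\<integral>\<^sup>+y. indicator A (f x) * indicator B (f x + y) \<partial>lborel) \<partial>lborel)"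
    by (intro nn_integral_cong)
       (simp add: nn_integral_cmult nn_integral_lborel_shift[where g="indicator B"])
  also have "\<dots> = (\<integral>\<^sup>+y. (\<integral>\<^sup>+x. indicator A (f x) * indicator B (f x + y) \<partial>lborel) \<partial>lborel)"
    by (rule lborel_pair.Fubini') measurable
  also have "\<dots> = (\<integral>\<^sup>+y. (\<integral>\<^sup>+x. indicator A (f x - y) * indicator B (f x) \<partial>lborel) \<partial>lborel)"
  proof (rule nn_integral_cong)
    fix y
    have "(\<integral>\<^sup>+x. indicator A (f x) * indicator B (f x + y) \<partial>lborel)
        = (\<integral>\<^sup>+x. indicator A (f (- g y + x)) * indicator B (f (- g y + x) + y) \<partial>lborel)"
      by (rule nn_integral_lborel_shift[symmetric]) measurable
    also have "\<dots> = (\<integral>\<^sup>+x. indicator A (f x - y) * indicator B (f x) \<partial>lborel)"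
      by (intro nn_integral_cong) (simp add: linear_add[OF f(1)] linear_diff[OF f(1)] g(3))
    finally show "(\<integral>\<^sup>+x. indicator A (f x) * indicator B (f x + y) \<partial>lborel)
      = (\<integral>\<^sup>+x. indicator A (f x - y) * indicator B (f x) \<partial>lborel)" .
  qed
  also have "\<dots> = (\<integral>\<^sup>+x. (\<integral>\<^sup>+y. indicator A (f x - y) * indicator B (f x) \<partial>lborel) \<partial>lborel)"
    by (rule lborel_pair.Fubini') measurable
  also have "\<dots> = (\<integral>\<^sup>+x. indicator B (f x) * emeasure lborel A \<partial>lborel)"
  proof (rule nn_integral_cong)
    fix x
    have "(\<integral>\<^sup>+y. indicator A (f x - y) \<partial>lborel) = (\<integral>\<^sup>+y. indicator A (f x + y) \<partial>lborel)"
      using nn_integral_lborel_reflect[of "\<lambda>y. indicator A (f x + y)"] by simp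
    also have "\<dots> = emeasure lborel A"
      by (simp add: nn_integral_lborel_shift[where g="indicator A"])
    finally show "(\<integral>\<^sup>+y. indicator A (f x - y) * indicator B (f x) \<partial>lborel) = indicator B (f x) * emeasure lborel A"
      by (subst nn_integral_multc) (auto simp: mult.commute)
  qed
  also have "\<dots> = emeasure lborel (f -` B) * emeasure lborel A"
    by (subst nn_integral_multc) (auto simp: vim[simplified] simp flip: nn_integral_indicator 
        intro!: nn_integral_cong arg_cong2[where f="(*)"] split: split_indicator)
  finally show ?thesis .
qed

text \<open>
  The cross ratio against the unit cube shows that \<open>A \<mapsto> |f\<^sup>-\<^sup>1 A|\<close> is a constant multiple of Lebesgue
  measure.
\<close>

lemma emeasure_lborel_linear_preimage:
  fixes f :: "'a::euclidean_space \<Rightarrow> 'a"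
  assumes f: "linear f" "bij f"
  obtains c where "0 \<le> c" "\<And>A. A \<in> sets borel \<Longrightarrow> emeasure lborel A = ennreal c * emeasure lborel (f -` A)"
proof -
  let ?U = "f -` box 0 One"
  have cont: "continuous_on UNIV f" by (simp add: f(1) linear_continuous_on linear_linear)
  obtain g where g: "linear g" "\<And>x. g (f x) = x" "\<And>x. f (g x) = x"
    using f by (metis bij_def linear_injective_left_inverse linear_surjective_right_inverse comp_apply id_apply bij_is_inj bij_is_surj)
  have "?U = g ` box 0 One" 
  proof safe
    fix x assume "f x \<in> box 0 One"
    then show "x \<in> g ` box 0 One" using imageI[of "f x" _ g] g(2) by simp
  qed (simp add: g(3))
  then have "bounded ?U" using bounded_linear_image[OF bounded_box] g(1) by (auto simp: linear_linear)
  then have fin: "emeasure lborel ?U < \<infinity>" by (rule emeasure_bounded_finite)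
  have op: "open ?U" using cont by (intro open_vimage) auto
  have "box 0 (One::'a) \<noteq> {}" by (simp add: box_ne_empty)
  with \<open>?U = g ` box 0 One\<close> have "?U \<noteq> {}" by simp
  then have "emeasure lborel ?U \<noteq> 0"
    using op open_not_negligible by (metis borel_open negligible_iff_null_sets null_setsI null_sets_completionI sets_lborel)
  with fin obtain m where m: "0 < m" "emeasure lborel ?U = ennreal m"
    by (cases "emeasure lborel ?U") (auto simp: less_le)
  show thesis
  proof (rule that[of "1/m"])
    fix A :: "'a set" assume A: "A \<in> sets borel"
    have "emeasure lborel (f -` A) = ennreal m * emeasure lborel A"
      using linear_preimage_cross_ratio[OF f A, of "box 0 One"] m by (simp add: emeasure_lborel_box_eq)
    then show "emeasure lborel A = ennreal (1/m) * emeasure lborel (f -` A)"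
      using m(1) by (simp add: mult.assoc[symmetric] ennreal_mult[symmetric])
  qed (use m in simp)
qed

text \<open>
  Since only a constant is unknown, it can be read off from a single test set \<open>B\<close>.
\<close>

lemma emeasure_lborel_linear_preimage_eqI:
  fixes f :: "'a::euclidean_space \<Rightarrow> 'a"
  assumes f: "linear f" "bij f" and B: "B \<in> sets borel" "emeasure lborel (f -` B) = ennreal b" "0 < b"
    and eq: "emeasure lborel B = ennreal (k * b)" and A: "A \<in> sets borel" and "0 \<le> k"
  shows "emeasure lborel A = ennreal k * emeasure lborel (f -` A)"
proof -
  obtain c where c: "0 \<le> c" "\<And>A. A \<in> sets borel \<Longrightarrow> emeasure lborel A = ennreal c * emeasure lborel (f -` A)"
    using emeasure_lborel_linear_preimage[OF f] by blast
  have "ennreal (k * b) = ennreal (c * b)"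
    using c(2)[OF B(1)] B eq c(1) by (simp add: ennreal_mult)
  then have "k = c" using B(3) c(1) \<open>0 \<le> k\<close> by (simp add: ennreal_inj)
  then show ?thesis using c(2)[OF A] by simp
qed

lemma emeasure_lborel_cart:
  fixes a b :: "real^'n"
  assumes "\<And>i. a $ i \<le> b $ i"
  shows "emeasure lborel (cbox a b) = ennreal (\<Prod>i\<in>UNIV. b $ i - a $ i)"
proof -
  have "cbox a b \<noteq> {}" using assms by (auto simp: interval_ne_empty_cart)
  then have "measure lborel (cbox a b) = (\<Prod>i\<in>UNIV. b $ i - a $ i)" by (rule content_cbox_cart)
  then show ?thesis
    using emeasure_eq_ennreal_measure[of lborel "cbox a b"] emeasure_lborel_cbox_finite[of a b] by simp
qed

text \<open>
  The constant is multiplicative in the map, so it suffices to compute it for elementary maps, each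
  on a convenient test set: a box for a diagonal map, the unit ball for a transposition of
  coordinates, and the sheared unit cube for a shear.
\<close>

theorem emeasure_lborel_linear_det:
  fixes f :: "real^'n \<Rightarrow> real^'n"
  assumes "linear f" "det (matrix f) \<noteq> 0" "A \<in> sets borel"
  shows "emeasure lborel A = ennreal \<bar>det (matrix f)\<bar> * emeasure lborel (f -` A)"
proof -
  have bij: "bij f" if "linear f" "det (matrix f) \<noteq> 0" for f :: "real^'n \<Rightarrow> real^'n"
    using that det_nz_iff_inj linear_injective_imp_surjective by (metis bijI)
  define P where "P f \<longleftrightarrow> (det (matrix f) \<noteq> 0 \<longrightarrow>
    (\<forall>A\<in>sets borel. emeasure lborel A = ennreal \<bar>det (matrix f)\<bar> * emeasure lborel (f -` A)))"
    for f :: "real^'n \<Rightarrow> real^'n"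
  have "P f"
  proof (rule induct_linear_elementary[OF \<open>linear f\<close>])
    fix f g :: "real^'n \<Rightarrow> real^'n"
    assume lin: "linear f" "linear g" and P: "P f" "P g"
    have d: "det (matrix (f \<circ> g)) = det (matrix f) * det (matrix g)"
      by (simp add: matrix_compose[OF lin(2,1)] det_mul)
    have "f \<in> borel_measurable borel"
      by (simp add: borel_measurable_continuous_onI lin(1) linear_continuous_on linear_linear)
    note vim = measurable_sets[OF this]
    show "P (f \<circ> g)" unfolding P_def
    proof (intro impI ballI)
      fix A :: "(real^'n) set"
      assume "det (matrix (f \<circ> g)) \<noteq> 0" and A: "A \<in> sets borel"
      then have nz: "det (matrix f) \<noteq> 0" "det (matrix g) \<noteq> 0" by (simp_all add: d)
      have "emeasure lborel A = ennreal \<bar>det (matrix f)\<bar> * emeasure lborel (f -` A)"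
        using P(1) nz A unfolding P_def by blast
      also have "emeasure lborel (f -` A) = ennreal \<bar>det (matrix g)\<bar> * emeasure lborel (g -` (f -` A))"
        using P(2) nz vim[OF A] unfolding P_def by simp
      finally show "emeasure lborel A = ennreal \<bar>det (matrix (f \<circ> g))\<bar> * emeasure lborel ((f \<circ> g) -` A)"
        by (simp only: d abs_mult ennreal_mult abs_ge_zero mult.assoc vimage_comp)
    qed
  next
    fix f :: "real^'n \<Rightarrow> real^'n" and i
    assume "linear f" and 0: "\<And>x. f x $ i = 0"
    then have "\<not> inj f"
      by (metis linear_injective_imp_surjective one_neq_zero surjE vec_component)
    then show "P f" unfolding P_def using det_nz_iff_inj[OF \<open>linear f\<close>] by blast
  next
    fix c :: "'n \<Rightarrow> real"
    let ?f = "\<lambda>x::real^'n. \<chi> i. c i * x $ i"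
    have lin: "linear ?f" by (rule linearI) (auto simp: vec_eq_iff algebra_simps)
    have det: "det (matrix ?f) = prod c UNIV"
      by (simp add: det_diagonal matrix_def axis_def)
    show "P ?f" unfolding P_def
    proof (intro impI ballI)
      fix A :: "(real^'n) set" assume nz: "det (matrix ?f) \<noteq> 0" and A: "A \<in> sets borel"
      then have c: "c i \<noteq> 0" for i by (simp add: det)
      let ?B = "cbox (\<chi> i. min 0 (c i)) (\<chi> i. max 0 (c i))"
      have "?f x \<in> ?B \<longleftrightarrow> x \<in> cbox 0 1" for x
      proof -
        have "min 0 (c i) \<le> c i * x $ i \<and> c i * x $ i \<le> max 0 (c i) \<longleftrightarrow> 0 \<le> x $ i \<and> x $ i \<le> 1" for i
          using c[of i] by (cases "c i > 0") (auto simp: min_def max_def zero_le_mult_iff mult_le_0_iff mult_le_cancel_left1 mult_le_cancel_left2)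
        then show ?thesis by (simp add: mem_box_cart)
      qed
      then have "?f -` ?B = cbox 0 1" by auto
      moreover have "emeasure lborel (cbox 0 (1::real^'n)) = ennreal 1"
        using emeasure_lborel_cart[of 0 "1::real^'n"] by simp
      moreover have "emeasure lborel ?B = ennreal (\<bar>det (matrix ?f)\<bar> * 1)"
      proof -
        have "max 0 (c i) - min 0 (c i) = \<bar>c i\<bar>" for i by simp
        then show ?thesis by (subst emeasure_lborel_cart) (simp_all add: det abs_prod)
      qed
      ultimately show "emeasure lborel A = ennreal \<bar>det (matrix ?f)\<bar> * emeasure lborel (?f -` A)"
        by (intro emeasure_lborel_linear_preimage_eqI[OF lin bij[OF lin nz], of ?B 1] A)
          auto
    qed
  next
    fix m n :: 'n assume "m \<noteq> n"
    let ?f = "\<lambda>x::real^'n. \<chi> i. x $ Transposition.transpose m n i"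
    have lin: "linear ?f" by (rule linearI) (auto simp: vec_eq_iff)
    have norm: "norm (?f x) = norm x" for x
      unfolding norm_vec_def L2_set_def
      by (auto intro!: arg_cong[where f=sqrt] sum.reindex_bij_witness[of _ "Transposition.transpose m n" "Transposition.transpose m n"])
    then have "orthogonal_transformation ?f" using lin by (simp add: orthogonal_transformation)
    then have det: "\<bar>det (matrix ?f)\<bar> = 1" by simp
    show "P ?f" unfolding P_def
    proof (intro impI ballI)
      fix A :: "(real^'n) set" assume nz: "det (matrix ?f) \<noteq> 0" and A: "A \<in> sets borel"
      have "?f -` ball 0 1 = ball 0 1" by (auto simp: norm)
      then show "emeasure lborel A = ennreal \<bar>det (matrix ?f)\<bar> * emeasure lborel (?f -` A)"
        by (intro emeasure_lborel_linear_preimage_eqI[OF lin bij[OF lin nz], of "ball 0 1" "measure lborel (ball 0 1)"] A)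
          (auto simp: det content_ball_pos
             intro!: emeasure_eq_ennreal_measure less_imp_neq[OF emeasure_bounded_finite, unfolded infinity_ennreal_def])
    qed
  next
    fix m n :: 'n assume mn: "m \<noteq> n"
    let ?f = "\<lambda>x::real^'n. \<chi> i. if i = m then x $ m + x $ n else x $ i"
    have lin: "linear ?f" by (rule linearI) (auto simp: vec_eq_iff algebra_simps)
    have "matrix ?f = (\<chi> k. if k = m then row m (mat 1) + 1 *s row n (mat 1) else row k (mat 1))"
      using mn by (auto simp: matrix_def vec_eq_iff row_def mat_def axis_def)
    then have det: "det (matrix ?f) = 1"
      using det_row_operation[OF mn, of "mat 1" 1] by simp
    show "P ?f" unfolding P_def
    proof (intro impI ballI)
      fix A :: "(real^'n) set" assume nz: "det (matrix ?f) \<noteq> 0" and A: "A \<in> sets borel"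
      have inj: "inj ?f" using bij[OF lin nz] by (simp add: bij_def)
      let ?C = "cbox 0 1 :: (real^'n) set"
      have C: "compact (?f ` ?C)"
        by (intro compact_continuous_image compact_cbox linear_continuous_on) (simp add: lin linear_linear)
      have "measure lebesgue (?f ` ?C) = measure lebesgue ?C"
        by (rule measure_shear_interval) (auto simp: mn interval_ne_empty_cart)
      then have "measure lborel (?f ` ?C) = measure lborel ?C"
        using C by (simp add: measure_completion borel_compact)
      moreover have C1: "emeasure lborel ?C = 1"
        using emeasure_lborel_cart[of 0 "1::real^'n"] by simp
      moreover have "measure lborel ?C = 1" by (simp add: measure_def C1)
      moreover have "emeasure lborel (?f ` ?C) = ennreal (measure lborel (?f ` ?C))"
        using emeasure_compact_finite[OF C] by (intro emeasure_eq_ennreal_measure) auto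
      ultimately have "emeasure lborel (?f ` ?C) = 1" "emeasure lborel ?C = 1"
        by simp_all
      then show "emeasure lborel A = ennreal \<bar>det (matrix ?f)\<bar> * emeasure lborel (?f -` A)"
        using C by (intro emeasure_lborel_linear_preimage_eqI[OF lin bij[OF lin nz], of "?f ` ?C" 1] A)
          (auto simp: det inj_vimage_image_eq[OF inj] borel_compact)
    qed
  qed
  then show ?thesis using assms unfolding P_def by blast
qed

text \<open>
  Passing from Borel to Lebesgue measurable functions needs the affine map to be measurable between
  the completions; this holds because the map and its inverse preserve null sets.
\<close>

lemma
  fixes W :: "real^'n^'n" and a :: "real^'n"
  assumes W: "det W \<noteq> 0"
  defines "T \<equiv> \<lambda>y. a + W *v y"
  shows affine_matrix_lebesgue_measurable: "T \<in> lebesgue \<rightarrow>\<^sub>M lebesgue"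
    and lebesgue_affine_matrix: "lebesgue = density (distr lebesgue lebesgue T) (\<lambda>_. ennreal \<bar>det W\<bar>)"
proof -
  have [measurable]: "T \<in> borel \<rightarrow>\<^sub>M borel"
    unfolding T_def by (intro borel_measurable_continuous_onI continuous_intros matrix_vector_mult_linear_continuous_on)
  have sets: "T -` A \<in> sets borel" if "A \<in> sets borel" for A
    using measurable_sets[OF \<open>T \<in> borel_measurable borel\<close> that] by simp
  have eqA: "emeasure lborel A = ennreal \<bar>det W\<bar> * emeasure lborel (T -` A)" if A: "A \<in> sets borel" for A
  proof -
    have "emeasure lborel A = emeasure (distr lborel borel ((+) a)) A"
      by (simp add: lborel_distr_plus)
    also have "\<dots> = emeasure lborel ((+) a -` A)"
      using A by (subst emeasure_distr) auto
    also have "\<dots> = ennreal \<bar>det W\<bar> * emeasure lborel ((*v) W -` ((+) a -` A))"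
      using emeasure_lborel_linear_det[of "(*v) W" "(+) a -` A"] W A
        measurable_sets[of "(+) a" borel borel A] by simp
    also have "(*v) W -` ((+) a -` A) = T -` A" by (auto simp: T_def)
    finally show ?thesis .
  qed
  have lborel_eq: "lborel = density (distr lborel borel T) (\<lambda>_. ennreal \<bar>det W\<bar>)"
    by (rule measure_eqI) (auto simp: emeasure_density_const emeasure_distr eqA)
  have eq: "null_sets lborel = null_sets (distr lebesgue lborel T)"
    using W by (auto simp: null_sets_def emeasure_distr measurable_completion eqA sets)
  show "T \<in> lebesgue \<rightarrow>\<^sub>M lebesgue"
    by (simp add: completion.measurable_completion2 eq measurable_completion)
  have "lebesgue = completion (density (distr lborel borel T) (\<lambda>_. ennreal \<bar>det W\<bar>))"
    using lborel_eq by simp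
  also have "\<dots> = density (completion (distr lebesgue lborel T)) (\<lambda>_. ennreal \<bar>det W\<bar>)"
    using W by (auto intro!: always_eventually completion_density_eq simp: distr_completion cong: distr_cong)
  also have "\<dots> = density (distr lebesgue lebesgue T) (\<lambda>_. ennreal \<bar>det W\<bar>)"
    by (subst completion.completion_distr_eq) (auto simp: eq measurable_completion)
  finally show "lebesgue = density (distr lebesgue lebesgue T) (\<lambda>_. ennreal \<bar>det W\<bar>)" .
qed

lemma
  fixes W :: "real^'n^'n" and a :: "real^'n" and u :: "real^'n \<Rightarrow> real"
  assumes W: "det W \<noteq> 0" and u: "integrable lebesgue u"
  shows integrable_affine_matrix: "integrable lebesgue (\<lambda>y. u (a + W *v y))"
    and integral_affine_matrix: "(LINT x|lebesgue. u x) = \<bar>det W\<bar> * (LINT y|lebesgue. u (a + W *v y))"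
proof -
  let ?T = "\<lambda>y. a + W *v y"
  note [measurable] = affine_matrix_lebesgue_measurable[OF W, of a]
  have um[measurable]: "u \<in> borel_measurable lebesgue" using u by simp
  have "integrable (density (distr lebesgue lebesgue ?T) (\<lambda>_. ennreal \<bar>det W\<bar>)) u"
    using u by (simp only: lebesgue_affine_matrix[OF W, of a, symmetric])
  then have "integrable (distr lebesgue lebesgue ?T) (\<lambda>x. \<bar>det W\<bar> *\<^sub>R u x)"
    by (subst (asm) integrable_density) auto
  then show "integrable lebesgue (\<lambda>y. u (a + W *v y))"
    using W by (subst (asm) integrable_distr_eq) auto
  have "(LINT x|lebesgue. u x) = (LINT x|density (distr lebesgue lebesgue ?T) (\<lambda>_. ennreal \<bar>det W\<bar>). u x)"
    by (simp only: lebesgue_affine_matrix[OF W, of a, symmetric])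
  also have "\<dots> = (LINT x|distr lebesgue lebesgue ?T. \<bar>det W\<bar> *\<^sub>R u x)"
    by (subst integral_density) auto
  also have "\<dots> = \<bar>det W\<bar> * (LINT y|lebesgue. u (a + W *v y))"
    by (subst integral_distr) auto
  finally show "(LINT x|lebesgue. u x) = \<bar>det W\<bar> * (LINT y|lebesgue. u (a + W *v y))" .
qed

lemma
  fixes W :: "real^'n^'n" and a :: "real^'n" and u :: "real^'n \<Rightarrow> real"
  assumes W: "det W \<noteq> 0" and u: "set_integrable lebesgue ((\<lambda>y. a + W *v y) ` S) u"
  shows set_integrable_affine_matrix: "set_integrable lebesgue S (\<lambda>y. u (a + W *v y))"
    and set_integral_affine_matrix:
      "(LINT x:(\<lambda>y. a + W *v y) ` S|lebesgue. u x) = \<bar>det W\<bar> * (LINT y:S|lebesgue. u (a + W *v y))"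
proof -
  have "inj ((*v) W)" using W det_nz_iff_inj[of "(*v) W"] by simp
  then have ind: "indicat_real ((\<lambda>y. a + W *v y) ` S) (a + W *v y) = indicat_real S y" for y
    by (auto simp: indicator_def image_iff inj_eq)
  show "set_integrable lebesgue S (\<lambda>y. u (a + W *v y))"
    using integrable_affine_matrix[OF W u[unfolded set_integrable_def], of a]
    by (simp add: set_integrable_def ind)
  show "(LINT x:(\<lambda>y. a + W *v y) ` S|lebesgue. u x) = \<bar>det W\<bar> * (LINT y:S|lebesgue. u (a + W *v y))"
    using integral_affine_matrix[OF W u[unfolded set_integrable_def], of a]
    by (simp add: set_lebesgue_integral_def ind)
qed

lemma
  fixes W :: "real^'n^'n"
  assumes W: "det W \<noteq> 0" and S: "S \<in> lmeasurable"
  shows lmeasurable_affine_matrix_image: "(\<lambda>y. a + W *v y) ` S \<in> lmeasurable"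
    and measure_affine_matrix_image:
      "measure lebesgue ((\<lambda>y. a + W *v y) ` S) = \<bar>det W\<bar> * measure lebesgue S"
proof -
  let ?T = "\<lambda>y. a + W *v y"
  obtain V where V: "V ** W = mat 1" "W ** V = mat 1"
    using W unfolding invertible_det_nz[symmetric] invertible_def by blast
  have detV: "det V \<noteq> 0" using arg_cong[OF V(1), of det] by (auto simp: det_mul)
  have eq: "?T ` S = (\<lambda>x. - (V *v a) + V *v x) -` S"
  proof safe
    fix y assume "y \<in> S"
    then show "?T y \<in> (\<lambda>x. - (V *v a) + V *v x) -` S"
      by (simp add: matrix_vector_right_distrib matrix_vector_mul_assoc V)
  next
    fix x assume "- (V *v a) + V *v x \<in> S"
    moreover have "x = ?T (- (V *v a) + V *v x)"
      by (simp add: matrix_vector_right_distrib matrix_vector_mult_diff_distrib matrix_vector_mul_assoc V)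
    ultimately show "x \<in> ?T ` S" by blast
  qed
  have sets: "?T ` S \<in> sets lebesgue"
    unfolding eq using measurable_sets[OF affine_matrix_lebesgue_measurable[OF detV, of "- (V *v a)"], of S] S by auto
  have inj: "inj ?T"
    using W det_nz_iff_inj[of "(*v) W"] by (auto simp: inj_def)
  have "emeasure lebesgue (?T ` S) = emeasure (density (distr lebesgue lebesgue ?T) (\<lambda>_. ennreal \<bar>det W\<bar>)) (?T ` S)"
    by (simp only: lebesgue_affine_matrix[OF W, of a, symmetric])
  also have "\<dots> = ennreal \<bar>det W\<bar> * emeasure lebesgue S"
    using sets by (simp add: emeasure_density_const emeasure_distr affine_matrix_lebesgue_measurable[OF W]
       inj_vimage_image_eq[OF inj] del: emeasure_completion)
  finally have *: "emeasure lebesgue (?T ` S) = ennreal \<bar>det W\<bar> * emeasure lebesgue S" .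
  show "?T ` S \<in> lmeasurable"
    using S sets by (auto simp: fmeasurable_def * ennreal_mult_less_top simp del: emeasure_completion)
  show "measure lebesgue (?T ` S) = \<bar>det W\<bar> * measure lebesgue S"
    by (simp add: measure_def * enn2real_mult del: emeasure_completion)
qed

section \<open>Symmetric matrices, square roots and the reflection coupling\<close>

lemma symmetric_matrix_inner:
  fixes A :: "real^'n^'n"
  assumes "transpose A = A"
  shows "(A *v x) \<bullet> y = x \<bullet> (A *v y)"
  using assms by (metis dot_lmul_matrix transpose_matrix_vector)

text \<open>
  A maximiser \<open>b\<close> of the quadratic form on the unit sphere of \<open>V\<close> is an eigenvector: the residual
  \<open>w = A b - k b\<close> again lies in \<open>V\<close>, and moving from \<open>b\<close> to \<open>b + t w\<close> changes
  \<open>v \<bullet> A v - k |v|\<^sup>2 \<le> 0\<close>, which vanishes at \<open>b\<close>, by \<open>2 t |w|\<^sup>2\<close> to first order.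
\<close>

lemma rayleigh_max_eigenvector:
  fixes A :: "real^'n^'n"
  assumes A: "transpose A = A" and V: "subspace V" "\<And>v. v \<in> V \<Longrightarrow> A *v v \<in> V" "V \<noteq> {0}"
  obtains b k where "b \<in> V" "norm b = 1" "A *v b = k *\<^sub>R b"
proof -
  let ?S = "V \<inter> sphere 0 1"
  let ?q = "\<lambda>v. v \<bullet> (A *v v)"
  obtain v0 where v0: "v0 \<in> V" "v0 \<noteq> 0" using V by (metis singleton_iff subspace_0 subsetI subset_singletonD empty_iff)
  have "compact ?S" using V(1) by (simp add: closed_subspace closed_Int_compact)
  moreover have "(1 / norm v0) *\<^sub>R v0 \<in> ?S" using v0 V(1) by (simp add: subspace_scale)
  moreover have "continuous_on ?S ?q"
    by (intro continuous_intros matrix_vector_mult_linear_continuous_on)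
  ultimately obtain b where b: "b \<in> ?S" and max: "\<And>v. v \<in> ?S \<Longrightarrow> ?q v \<le> ?q b"
    using continuous_attains_sup[of ?S ?q] by blast
  let ?k = "?q b" and ?w = "A *v b - ?q b *\<^sub>R b"
  have le: "?q v \<le> ?k * (norm v)\<^sup>2" if "v \<in> V" for v
  proof (cases "v = 0")
    case False
    then have "?q ((1 / norm v) *\<^sub>R v) \<le> ?k"
      by (intro max) (use that V(1) in \<open>simp add: subspace_scale\<close>)
    moreover have "?q ((1 / norm v) *\<^sub>R v) = ?q v / (norm v)\<^sup>2"
      by (simp add: matrix_vector_mult_scaleR power2_eq_square)
    ultimately have "?q v / (norm v)\<^sup>2 \<le> ?k" by metis
    then show ?thesis using False by (simp add: divide_le_eq)
  qed simp
  have nb: "b \<bullet> b = 1" using b by (simp add: norm_eq_1)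
  have wV: "?w \<in> V" using b V by (simp add: subspace_diff subspace_scale)
  define c where "c = ?q ?w - ?k * (norm ?w)\<^sup>2"
  have quad: "2 * t * (norm ?w)\<^sup>2 + t\<^sup>2 * c \<le> 0" for t
  proof -
    have "b + t *\<^sub>R ?w \<in> V" using b wV V(1) by (simp add: subspace_add subspace_scale)
    from le[OF this] have "?q (b + t *\<^sub>R ?w) - ?k * (norm (b + t *\<^sub>R ?w))\<^sup>2 \<le> 0" by simp
    moreover have q: "?q (b + t *\<^sub>R ?w) = ?k + 2 * t * (?w \<bullet> (A *v b)) + t\<^sup>2 * ?q ?w"
    proof -
      have "b \<bullet> (A *v ?w) = ?w \<bullet> (A *v b)"
        using symmetric_matrix_inner[OF A, of b ?w] by (simp add: inner_commute)
      then show ?thesis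
        by (simp only: matrix_vector_right_distrib matrix_vector_mult_scaleR inner_add_left inner_add_right
            inner_scaleR_left inner_scaleR_right) (simp add: power2_eq_square algebra_simps)
    qed
    moreover have n: "(norm (b + t *\<^sub>R ?w))\<^sup>2 = 1 + 2 * t * (?w \<bullet> b) + t\<^sup>2 * (norm ?w)\<^sup>2"
      unfolding power2_norm_eq_inner
      by (simp only: inner_add_left inner_add_right inner_scaleR_left inner_scaleR_right nb)
         (simp add: inner_commute power2_eq_square distrib_left mult_ac)
    ultimately have "?k + 2 * t * (?w \<bullet> (A *v b)) + t\<^sup>2 * ?q ?w
        - ?k * (1 + 2 * t * (?w \<bullet> b) + t\<^sup>2 * (norm ?w)\<^sup>2) \<le> 0"
      by (simp only: q n)
    moreover have "(norm ?w)\<^sup>2 = ?w \<bullet> (A *v b) - ?k * (?w \<bullet> b)"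
      unfolding power2_norm_eq_inner by (simp only: inner_diff_right inner_scaleR_right)
    moreover have "2 * t * N + t\<^sup>2 * (R - K * N) \<le> 0"
      if "K + 2 * t * P + t\<^sup>2 * R - K * (1 + 2 * t * X + t\<^sup>2 * N) \<le> 0" "N = P - K * X" for K P R X N :: real
    proof -
      have "2 * t * (P - K * X) + t\<^sup>2 * (R - K * N) \<le> 0" using that(1) by (simp add: algebra_simps)
      then show ?thesis by (simp only: that(2)[symmetric])
    qed
    ultimately show ?thesis unfolding c_def by blast
  qed
  have "norm ?w = 0"
  proof (rule ccontr)
    assume "norm ?w \<noteq> 0"
    define m where "m = (norm ?w)\<^sup>2"
    have m: "m > 0" using \<open>norm ?w \<noteq> 0\<close> unfolding m_def by (simp add: zero_less_power2 del: norm_eq_zero)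
    \<comment> \<open>so small that the quadratic term loses against the linear one\<close>
    define t where "t = m / (\<bar>c\<bar> + 1)"
    have t: "t > 0" using m by (simp add: t_def)
    have "2 * t * m + t\<^sup>2 * c \<ge> 2 * t * m - t * m"
    proof -
      have "t * \<bar>c\<bar> \<le> m" using m by (simp add: t_def field_simps)
      then have "t * (t * \<bar>c\<bar>) \<le> t * m" using t by (intro mult_left_mono) auto
      moreover have "t\<^sup>2 * c \<ge> - (t * (t * \<bar>c\<bar>))" using t
        by (simp add: power2_eq_square mult.assoc) (metis abs_ge_minus_self minus_le_iff mult_left_mono mult_minus_right less_imp_le)
      ultimately show ?thesis by linarith
    qed
    then show False using quad[of t, folded m_def] mult_pos_pos[OF t m] by linarith
  qed
  then have "A *v b = ?k *\<^sub>R b" by simp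
  then show thesis using that[of b ?k] b by simp
qed

text \<open>
  Split off one eigenvector \<open>b\<close>; its orthogonal complement inside \<open>V\<close> is invariant because \<open>A\<close> is
  symmetric, and has smaller dimension.
\<close>

lemma symmetric_matrix_eigenbasis_subspace:
  fixes A :: "real^'n^'n"
  assumes A: "transpose A = A"
  shows "subspace V \<Longrightarrow> (\<And>v. v \<in> V \<Longrightarrow> A *v v \<in> V) \<Longrightarrow>
    \<exists>B. finite B \<and> span B = V \<and> pairwise orthogonal B \<and> (\<forall>b\<in>B. norm b = 1 \<and> (\<exists>k. A *v b = k *\<^sub>R b))"
proof (induction "dim V" arbitrary: V rule: less_induct)
  case less
  show ?case
  proof (cases "V = {0}")
    case True
    then show ?thesis by (intro exI[of _ "{}"]) auto
  next
    case False
    obtain b k where b: "b \<in> V" "norm b = 1" "A *v b = k *\<^sub>R b"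
      using rayleigh_max_eigenvector[OF A less.prems False] by blast
    define W where "W = {v \<in> V. v \<bullet> b = 0}"
    have bb: "b \<bullet> b = 1" using b by (simp add: norm_eq_1)
    have W: "subspace W" using less.prems(1) unfolding W_def subspace_def by (auto simp: inner_add_left)
    have WV: "W \<subseteq> V" by (auto simp: W_def)
    have "dim W < dim V"
    proof (rule dim_psubset)
      show "span W \<subset> span V"
      proof -
        have "b \<notin> W" using bb by (simp add: W_def)
        then show ?thesis using W less.prems(1) WV b(1) by (metis span_eq_iff psubsetI)
      qed
    qed
    moreover have "A *v v \<in> W" if "v \<in> W" for v
      using that less.prems(2) symmetric_matrix_inner[OF A, of v b] b by (auto simp: W_def)
    ultimately obtain B where B: "finite B" "span B = W" "pairwise orthogonal B"
        "\<forall>b\<in>B. norm b = 1 \<and> (\<exists>k. A *v b = k *\<^sub>R b)"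
      using less.hyps[OF _ W] by blast
    have "span (insert b B) = V"
    proof
      show "span (insert b B) \<subseteq> V"
        using b B WV less.prems(1) span_superset[of B] by (intro span_minimal) auto
      show "V \<subseteq> span (insert b B)"
      proof
        fix v assume v: "v \<in> V"
        then have "v - (v \<bullet> b) *\<^sub>R b \<in> span B"
          using b bb less.prems(1) unfolding B W_def by (simp add: subspace_diff subspace_scale inner_diff_left)
        then show "v \<in> span (insert b B)" unfolding span_breakdown_eq by blast
      qed
    qed
    moreover have "orthogonal b x" "orthogonal x b" if "x \<in> B" for x
      using that B(2) span_superset[of B] by (auto simp: W_def orthogonal_def inner_commute)
    then have "pairwise orthogonal (insert b B)" using B(3) by (auto simp: pairwise_insert)
    ultimately show ?thesis using B b by (intro exI[of _ "insert b B"]) auto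
  qed
qed

text \<open>
  Take the square roots of the eigenvalues in an orthonormal eigenbasis. The lower bound of the
  form bounds the eigenvalues, hence also the form of the root, from below.
\<close>

theorem positive_sqrt_exists:
  fixes A :: "real^'n^'n"
  assumes A: "transpose A = A" and "0 \<le> m" and lower: "\<And>v. m * (norm v)\<^sup>2 \<le> v \<bullet> (A *v v)"
  obtains S where "transpose S = S" "S ** S = A" "\<And>v. sqrt m * (norm v)\<^sup>2 \<le> v \<bullet> (S *v v)"
proof -
  obtain B where B: "finite B" "span B = UNIV" "pairwise orthogonal B"
      and eig: "\<forall>b\<in>B. norm b = 1 \<and> (\<exists>k. A *v b = k *\<^sub>R b)"
    using symmetric_matrix_eigenbasis_subspace[OF A, of UNIV] by auto
  then obtain k where k: "\<And>b. b \<in> B \<Longrightarrow> A *v b = k b *\<^sub>R b" by metis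
  have nb: "norm b = 1" "b \<bullet> b = 1" if "b \<in> B" for b using eig that by (auto simp: norm_eq_1)
  have mk: "m \<le> k b" if "b \<in> B" for b using lower[of b] k[OF that] nb[OF that] by simp
  have expand: "(\<Sum>b\<in>B. (b \<bullet> v) *\<^sub>R b) = v" for v
    using orthonormal_basis_expand[OF B(3) nb(1) _ B(1), of v] B(2) by (simp add: inner_commute)
  define f where "f v = (\<Sum>b\<in>B. (sqrt (k b) * (b \<bullet> v)) *\<^sub>R b)" for v
  have lin: "linear f" unfolding f_def
    by (rule linearI) (simp_all add: inner_add_right algebra_simps sum.distrib scaleR_sum_right)
  have fb: "f b = sqrt (k b) *\<^sub>R b" if b: "b \<in> B" for b
  proof -
    have "f b = (\<Sum>c\<in>B. if c = b then sqrt (k b) *\<^sub>R b else 0)" unfolding f_def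
      by (rule sum.cong) (use B(3) b nb in \<open>auto simp: pairwise_def orthogonal_def\<close>)
    then show ?thesis using b B(1) by simp
  qed
  have ffA: "f (f v) = A *v v" for v
  proof -
    have "f (f v) = (\<Sum>b\<in>B. (sqrt (k b) * (b \<bullet> v)) *\<^sub>R f b)"
      unfolding f_def[of v] using lin by (simp add: linear_sum linear_scale)
    also have "\<dots> = (\<Sum>b\<in>B. (b \<bullet> v) *\<^sub>R (A *v b))"
    proof (rule sum.cong)
      fix b assume b: "b \<in> B"
      have "sqrt (k b) * sqrt (k b) = k b" using mk[OF b] \<open>0 \<le> m\<close> by simp
      then show "(sqrt (k b) * (b \<bullet> v)) *\<^sub>R f b = (b \<bullet> v) *\<^sub>R (A *v b)"
        using fb[OF b] k[OF b] by (simp add: mult.commute mult.left_commute)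
    qed simp
    also have "\<dots> = A *v (\<Sum>b\<in>B. (b \<bullet> v) *\<^sub>R b)"
      by (simp add: linear_sum[OF matrix_vector_mul_linear] matrix_vector_mult_scaleR)
    finally show ?thesis by (simp add: expand)
  qed
  have inner_f: "v \<bullet> f w = (\<Sum>b\<in>B. sqrt (k b) * (b \<bullet> v) * (b \<bullet> w))" for v w
    unfolding f_def inner_sum_right by (simp add: inner_commute mult_ac)
  define S where "S = matrix f"
  have S: "S *v v = f v" for v unfolding S_def by (simp add: matrix_works lin linear_matrix_vector_mul_eq)
  show thesis
  proof
    show "transpose S = S"
    proof -
      have "x \<bullet> (transpose S *v y) = x \<bullet> (S *v y)" for x y
      proof -
        have "x \<bullet> (transpose S *v y) = (S *v x) \<bullet> y"
          by (metis dot_lmul_matrix inner_commute transpose_matrix_vector transpose_transpose)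
        also have "\<dots> = x \<bullet> (S *v y)" by (simp add: S inner_f inner_commute[of "f x"] mult_ac)
        finally show ?thesis .
      qed
      then show ?thesis by (metis matrix_eq vector_eq_rdot inner_commute)
    qed
    show "S ** S = A" by (simp add: matrix_eq S ffA flip: matrix_vector_mul_assoc)
    show "sqrt m * (norm v)\<^sup>2 \<le> v \<bullet> (S *v v)" for v
    proof -
      have "(norm v)\<^sup>2 = v \<bullet> (\<Sum>b\<in>B. (b \<bullet> v) *\<^sub>R b)" by (simp add: expand power2_norm_eq_inner)
      also have "\<dots> = (\<Sum>b\<in>B. (b \<bullet> v)\<^sup>2)" by (simp add: inner_sum_right inner_commute power2_eq_square)
      finally have "sqrt m * (norm v)\<^sup>2 = (\<Sum>b\<in>B. sqrt m * (b \<bullet> v)\<^sup>2)" by (simp add: sum_distrib_left)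
      also have "\<dots> \<le> (\<Sum>b\<in>B. sqrt (k b) * (b \<bullet> v)\<^sup>2)"
        by (intro sum_mono mult_right_mono) (auto simp: mk)
      also have "\<dots> = v \<bullet> (S *v v)" by (simp add: S inner_f power2_eq_square mult.assoc)
      finally show ?thesis .
    qed
  qed
qed

lemma transpose_diff: "transpose (X - Y) = transpose X - transpose (Y :: real^'n^'m)"
  by (simp add: transpose_def vec_eq_iff)

lemma trace_transpose: "trace (transpose A) = trace A"
  by (simp add: trace_def transpose_def)

lemma trace_sum_inner: "trace (A :: real^'n^'n) = (\<Sum>i\<in>UNIV. axis i 1 \<bullet> (A *v axis i 1))"
  by (simp add: trace_def matrix_vector_mult_basis column_def inner_axis')

lemma trace_conj_sum_inner:
  fixes A D :: "real^'n^'n"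
  shows "trace (transpose D ** A ** D) = (\<Sum>i\<in>UNIV. (D *v axis i 1) \<bullet> (A *v (D *v axis i 1)))"
proof -
  have "axis i 1 \<bullet> ((transpose D ** A ** D) *v axis i 1) = (D *v axis i 1) \<bullet> (A *v (D *v axis i 1))" for i
    by (metis dot_lmul_matrix matrix_vector_mul_assoc transpose_matrix_vector transpose_transpose)
  then show ?thesis by (simp add: trace_sum_inner)
qed

lemma
  fixes A B C :: "real^'n^'n"
  shows matrix_mult_diff_left: "(A - B) ** C = A ** C - B ** C"
    and matrix_mult_diff_right: "A ** (B - C) = A ** B - A ** C"
  by (simp_all add: matrix_matrix_mult_def vec_eq_iff algebra_simps sum_subtractf)

text \<open>
  If \<open>S\<^sup>2 = T\<^sup>2\<close>, then \<open>D = S - T\<close> satisfies \<open>S D + D T = 0\<close>. Multiplying by \<open>D\<close> and taking traces gives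
  \<open>tr (D S D) + tr (D T D) = 0\<close>, where both terms are nonnegative; the first one is the sum of
  the values of the form of \<open>S\<close> at the columns of \<open>D\<close>, so these columns vanish.
\<close>

lemma pos_def_sqrt_unique:
  assumes S: "pos_def_matrix S" and T: "pos_def_matrix T" and eq: "S ** S = T ** T"
  shows "S = T"
proof -
  let ?D = "S - T"
  have sym: "transpose S = S" "transpose T = T" using S T by (auto simp: pos_def_matrix_def)
  have symD: "transpose ?D = ?D" using sym by (simp add: transpose_diff)
  have "S ** ?D + ?D ** T = 0"
    using eq by (simp add: matrix_mult_diff_right matrix_mult_diff_left)
  then have "trace (?D ** (S ** ?D + ?D ** T)) = 0" by (simp add: trace_def)
  then have "trace (?D ** S ** ?D) + trace (?D ** ?D ** T) = 0"
    by (simp add: matrix_add_ldistrib trace_add matrix_mul_assoc)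
  moreover have "trace (?D ** ?D ** T) = trace (?D ** T ** ?D)"
    using trace_mul_sym[of "?D" "?D ** T"] by (simp add: matrix_mul_assoc)
  ultimately have "trace (transpose ?D ** S ** ?D) + trace (transpose ?D ** T ** ?D) = 0" by (simp add: symD)
  then have "(\<Sum>i\<in>UNIV. (?D *v axis i 1) \<bullet> (S *v (?D *v axis i 1)) + (?D *v axis i 1) \<bullet> (T *v (?D *v axis i 1))) = 0"
    by (simp add: trace_conj_sum_inner sum.distrib)
  moreover have nonneg: "0 \<le> v \<bullet> (S *v v)" "0 \<le> v \<bullet> (T *v v)" for v
    using S T unfolding pos_def_matrix_def by (cases "v = 0"; force intro: less_imp_le)+
  ultimately have *: "(?D *v axis i 1) \<bullet> (S *v (?D *v axis i 1)) + (?D *v axis i 1) \<bullet> (T *v (?D *v axis i 1)) = 0" for i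
    by (subst (asm) sum_nonneg_eq_0_iff) (auto intro: add_nonneg_nonneg)
  have "?D *v axis i 1 = 0" for i
  proof (rule ccontr)
    assume "?D *v axis i 1 \<noteq> 0"
    then have "0 < (?D *v axis i 1) \<bullet> (S *v (?D *v axis i 1))"
      using S unfolding pos_def_matrix_def by blast
    then show False using *[of i] nonneg(2)[of "?D *v axis i 1"] by linarith
  qed
  then have "column i ?D = 0" for i by (simp add: matrix_vector_mult_basis)
  then show ?thesis by (simp add: column_def vec_eq_iff)
qed

text \<open>
  For \<open>l > 0\<close>: symmetric with all eigenvalues in \<open>[l, L]\<close>. The roots \<open>A(x)\<^sup>1\<^sup>/\<^sup>2\<close> are of this kind with
  \<open>l = \<surd>\<lambda>\<close> and \<open>L = \<surd>\<Lambda>\<close>.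
\<close>

definition pinched :: "real \<Rightarrow> real \<Rightarrow> real^'n^'n \<Rightarrow> bool" where
  "pinched l L S \<longleftrightarrow> transpose S = S \<and> (\<forall>v. l * (norm v)\<^sup>2 \<le> v \<bullet> (S *v v)) \<and> (\<forall>v. norm (S *v v) \<le> L * norm v)"

lemma pinched_norm_ge:
  assumes "pinched l L S"
  shows "l * norm v \<le> norm (S *v v)"
proof (cases "v = 0")
  case False
  have "l * (norm v)\<^sup>2 \<le> v \<bullet> (S *v v)" using assms by (auto simp: pinched_def)
  also have "\<dots> \<le> norm v * norm (S *v v)" by (rule norm_cauchy_schwarz)
  finally have "norm v * (l * norm v) \<le> norm v * norm (S *v v)" by (simp add: power2_eq_square mult_ac)
  then show ?thesis using False by simp
qed simp

lemma pinched_det_nonzero: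
  assumes "pinched l L S" "0 < l"
  shows "det S \<noteq> 0"
proof -
  have "v = 0" if "S *v v = 0" for v
    using pinched_norm_ge[OF assms(1), of v] that assms(2) by (simp add: mult_le_0_iff)
  then have "inj ((*v) S)"
    by (subst linear_injective_0) auto
  then show ?thesis using det_nz_iff_inj[of "(*v) S"] by simp
qed

theorem matrix_sqrt_elliptic:
  fixes A :: "real^'n^'n"
  assumes A: "A \<in> elliptic_matrices lam Lam" and lam: "0 < lam"
  shows pinched_matrix_sqrt: "pinched (sqrt lam) (sqrt Lam) (matrix_sqrt A)"
    and matrix_sqrt_square: "matrix_sqrt A ** matrix_sqrt A = A"
proof -
  have symA: "transpose A = A" and lower: "\<And>v. lam * (norm v)\<^sup>2 \<le> v \<bullet> (A *v v)"
    and upper: "\<And>v. v \<bullet> (A *v v) \<le> Lam * (norm v)\<^sup>2"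
    using A by (auto simp: elliptic_matrices_def)
  obtain S where S: "transpose S = S" "S ** S = A" "\<And>v. sqrt lam * (norm v)\<^sup>2 \<le> v \<bullet> (S *v v)"
    using positive_sqrt_exists[OF symA less_imp_le[OF lam] lower] by blast
  have "0 < v \<bullet> (S *v v)" if "v \<noteq> 0" for v
  proof -
    have "0 < sqrt lam * (norm v)\<^sup>2" using lam that by simp
    then show ?thesis using S(3)[of v] by linarith
  qed
  then have "pos_def_matrix S" using S(1) by (simp add: pos_def_matrix_def)
  then have eq: "matrix_sqrt A = S"
    unfolding matrix_sqrt_def using S(2) by (intro the_equality) (auto intro: pos_def_sqrt_unique)
  show "matrix_sqrt A ** matrix_sqrt A = A" using eq S by simp
  have "norm (S *v v) \<le> sqrt Lam * norm v" for v
  proof -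
    have "(norm (S *v v))\<^sup>2 = v \<bullet> (A *v v)"
      unfolding power2_norm_eq_inner symmetric_matrix_inner[OF S(1)] by (simp add: matrix_vector_mul_assoc S(2))
    then have "(norm (S *v v))\<^sup>2 \<le> Lam * (norm v)\<^sup>2" using upper by simp
    then have "norm (S *v v) \<le> sqrt (Lam * (norm v)\<^sup>2)" by (rule real_le_rsqrt)
    then show ?thesis by (simp add: real_sqrt_mult)
  qed
  then show "pinched (sqrt lam) (sqrt Lam) (matrix_sqrt A)" using eq S by (simp add: pinched_def)
qed

text \<open>
  The left-hand side is the trace of \<open>S\<^sup>2\<close> with the sign of the entry in direction \<open>e\<close> reversed. In an
  orthonormal basis containing \<open>e\<close> each of the other \<open>n - 1\<close> diagonal entries is at most \<open>L\<^sup>2\<close>.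
\<close>

lemma trace_minus_twice_diagonal_le:
  fixes S :: "real^'n^'n"
  assumes S: "pinched l L S" and e: "norm e = 1" and l: "0 \<le> l"
  shows "trace (S ** S) - 2 * (norm (S *v e))\<^sup>2 \<le> (real CARD('n) - 1) * L\<^sup>2 - l\<^sup>2"
proof -
  obtain k :: 'n where True by simp
  obtain R :: "real^'n^'n" where R: "orthogonal_matrix R" "R *v axis k 1 = e"
    using orthogonal_matrix_exists_basis[OF e] by blast
  have sym: "transpose S = S" using S by (simp add: pinched_def)
  have RR: "R ** transpose R = mat 1" using R(1) by (simp add: orthogonal_matrix_def)
  have nR: "norm (R *v axis i 1) = 1" for i
    using R(1) orthogonal_matrix_orthonormal_columns[of R] by (simp add: matrix_vector_mult_basis)
  have "trace (transpose R ** (S ** S) ** R) = trace ((S ** S) ** R ** transpose R)"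
    using trace_mul_sym[of "transpose R" "(S ** S) ** R"] by (simp add: matrix_mul_assoc)
  also have "\<dots> = trace (S ** S)" by (simp add: RR flip: matrix_mul_assoc)
  finally have "trace (S ** S) = (\<Sum>i\<in>UNIV. (norm (S *v (R *v axis i 1)))\<^sup>2)"
    by (simp only: trace_conj_sum_inner power2_norm_eq_inner symmetric_matrix_inner[OF sym]
         matrix_vector_mul_assoc[of S S, symmetric])
  also have "\<dots> = (norm (S *v e))\<^sup>2 + (\<Sum>i\<in>UNIV-{k}. (norm (S *v (R *v axis i 1)))\<^sup>2)"
    by (subst sum.remove[of _ k]) (simp_all add: R(2))
  also have "(\<Sum>i\<in>UNIV-{k}. (norm (S *v (R *v axis i 1)))\<^sup>2) \<le> (\<Sum>i\<in>UNIV-{k}. L\<^sup>2)"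
  proof (rule sum_mono)
    fix i
    have "norm (S *v (R *v axis i 1)) \<le> L" using S nR[of i] unfolding pinched_def by (metis mult.right_neutral)
    then show "(norm (S *v (R *v axis i 1)))\<^sup>2 \<le> L\<^sup>2" by (intro power_mono) auto
  qed
  also have "(\<Sum>i\<in>UNIV-{k}. L\<^sup>2) = (real CARD('n) - 1) * L\<^sup>2"
    by (simp add: card_Diff_singleton of_nat_diff Suc_leI)
  finally have "trace (S ** S) \<le> (norm (S *v e))\<^sup>2 + (real CARD('n) - 1) * L\<^sup>2" by simp
  moreover have "l\<^sup>2 \<le> (norm (S *v e))\<^sup>2"
    using pinched_norm_ge[OF S, of e] e l by (intro power_mono) auto
  ultimately show ?thesis by simp
qed

text \<open>
  Polar decomposition: \<open>Q\<close> undoes the orthogonal factor of \<open>N\<close>, so that \<open>Q N\<close> is the positive root \<open>P\<close>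
  of \<open>N\<^sup>T N\<close>, all of whose eigenvalues are at least \<open>m\<close>.
\<close>

lemma orthogonal_trace_ge:
  fixes N :: "real^'n^'n"
  assumes m: "0 < m" and N: "\<And>v. m * norm v \<le> norm (N *v v)"
  obtains Q where "orthogonal_matrix Q" "real CARD('n) * m \<le> trace (Q ** N)"
proof -
  let ?G = "transpose N ** N"
  have sym: "transpose ?G = ?G" by (simp add: matrix_transpose_mul)
  have "m\<^sup>2 * (norm v)\<^sup>2 \<le> v \<bullet> (?G *v v)" for v
  proof -
    have "v \<bullet> (?G *v v) = (norm (N *v v))\<^sup>2"
      by (metis dot_lmul_matrix matrix_vector_mul_assoc power2_norm_eq_inner transpose_matrix_vector transpose_transpose)
    moreover have "(m * norm v)\<^sup>2 \<le> (norm (N *v v))\<^sup>2" using N[of v] m by (intro power_mono) auto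
    ultimately show ?thesis by (simp add: power_mult_distrib)
  qed
  then obtain P where P: "transpose P = P" "P ** P = ?G" "\<And>v. m * (norm v)\<^sup>2 \<le> v \<bullet> (P *v v)"
    using positive_sqrt_exists[OF sym, of "m\<^sup>2"] m by (metis abs_of_pos real_sqrt_abs zero_le_power2)
  have "v = 0" if "N *v v = 0" for v
    using N[of v] that m by (simp add: mult_le_0_iff)
  then have "inj ((*v) N)" by (subst linear_injective_0) auto
  then have "det N \<noteq> 0" using det_nz_iff_inj[of "(*v) N"] by simp
  then obtain V where V: "V ** N = mat 1" "N ** V = mat 1"
    unfolding invertible_det_nz[symmetric] invertible_def by blast
  define Q where "Q = P ** V"
  have "transpose Q ** Q = transpose V ** (P ** P) ** V"
    by (simp add: Q_def matrix_transpose_mul P(1) matrix_mul_assoc)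
  also have "\<dots> = transpose (N ** V) ** (N ** V)"
    by (simp add: P(2) matrix_transpose_mul matrix_mul_assoc)
  finally have "orthogonal_matrix Q" by (simp add: V orthogonal_matrix)
  moreover have "Q ** N = P" by (simp add: Q_def V flip: matrix_mul_assoc)
  moreover have "real CARD('n) * m \<le> trace P"
  proof -
    have "(\<Sum>i\<in>(UNIV::'n set). m) \<le> trace P" unfolding trace_sum_inner
      by (rule sum_mono) (use P(3)[of "axis _ 1"] in simp)
    then show ?thesis by simp
  qed
  ultimately show thesis using that by simp
qed

text \<open>
  This is the place where the ellipticity ratio enters. Let \<open>J\<close> be the reflection in the hyperplane
  orthogonal to \<open>e\<close> and \<open>M = S - T Q\<close>. The left-hand side is the trace of
  \<open>J M M\<^sup>T = J S\<^sup>2 + J T\<^sup>2 - J S Q\<^sup>T T - J T Q S\<close>. The first two terms contribute at most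
  \<open>2 ((n - 1) L\<^sup>2 - l\<^sup>2)\<close>, and the last two are both equal to the trace of \<open>Q (S J T)\<close>, which a suitable
  \<open>Q\<close> makes at least \<open>n l\<^sup>2\<close> because \<open>S J T\<close> scales lengths by a factor of at least \<open>l\<^sup>2\<close>. For \<open>S = T = 1\<close>
  this \<open>Q\<close> is the mirror coupling \<open>Q = J\<close>.
\<close>

theorem reflection_coupling:
  fixes S T :: "real^'n^'n"
  assumes S: "pinched l L S" and T: "pinched l L T" and l: "0 < l" and e: "norm e = 1"
  obtains Q where "orthogonal_matrix Q"
    "trace ((S - T ** Q) ** transpose (S - T ** Q)) - 2 * (norm (transpose (S - T ** Q) *v e))\<^sup>2
       \<le> 2 * ((real CARD('n) - 1) * L\<^sup>2 - (real CARD('n) + 1) * l\<^sup>2)"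
proof -
  have sym: "transpose S = S" "transpose T = T" using S T by (auto simp: pinched_def)
  define J :: "real^'n^'n" where "J = (\<chi> i j. (if i = j then 1 else 0) - 2 * e $ i * e $ j)"
  have Jv: "J *v v = v - (2 * (e \<bullet> v)) *\<^sub>R e" for v
  proof -
    have "(J *v v) $ i = (v - (2 * (e \<bullet> v)) *\<^sub>R e) $ i" for i
      by (simp add: J_def matrix_vector_mult_def inner_vec_def left_diff_distrib sum_subtractf
           if_distrib[of "\<lambda>x. x * y" for y] cong: if_cong) (simp add: sum_distrib_left sum_distrib_right mult_ac)
    then show ?thesis by (simp add: vec_eq_iff)
  qed
  have symJ: "transpose J = J" by (auto simp: J_def transpose_def vec_eq_iff)
  have trJ: "trace (J ** X) = trace X - 2 * (e \<bullet> (X *v e))" for X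
  proof -
    have "trace (J ** X) = (\<Sum>i\<in>UNIV. X $ i $ i - (\<Sum>j\<in>UNIV. 2 * e $ i * e $ j * X $ j $ i))"
      by (simp add: trace_def J_def matrix_matrix_mult_def left_diff_distrib sum_subtractf
           if_distrib[of "\<lambda>x. x * y" for y] cong: if_cong)
    also have "\<dots> = trace X - (\<Sum>j\<in>UNIV. \<Sum>i\<in>UNIV. 2 * e $ i * e $ j * X $ j $ i)"
      by (subst sum.swap) (simp add: trace_def sum_subtractf)
    also have "(\<Sum>j\<in>UNIV. \<Sum>i\<in>UNIV. 2 * e $ i * e $ j * X $ j $ i) = 2 * (e \<bullet> (X *v e))"
      by (simp add: inner_vec_def matrix_vector_mult_def sum_distrib_left mult_ac)
    finally show ?thesis .
  qed
  have nJ: "norm (J *v v) = norm v" for v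
  proof -
    have "(norm (J *v v))\<^sup>2 = (norm v)\<^sup>2" using e
      unfolding Jv power2_norm_eq_inner norm_eq_1 by (simp add: inner_diff_left inner_diff_right inner_commute algebra_simps)
    then show ?thesis by simp
  qed
  have "l * l * norm v \<le> norm ((S ** J ** T) *v v)" for v
  proof -
    have "l * (l * norm v) \<le> l * norm (T *v v)" using pinched_norm_ge[OF T, of v] l by (intro mult_left_mono) auto
    also have "\<dots> = l * norm (J *v (T *v v))" by (simp add: nJ)
    also have "\<dots> \<le> norm (S *v (J *v (T *v v)))" by (rule pinched_norm_ge[OF S])
    finally show ?thesis by (simp add: matrix_vector_mul_assoc matrix_mul_assoc mult.assoc)
  qed
  then obtain Q where Q: "orthogonal_matrix Q" "real CARD('n) * (l * l) \<le> trace (Q ** (S ** J ** T))"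
    using orthogonal_trace_ge[of "l * l" "S ** J ** T"] l by (metis mult_pos_pos)
  let ?M = "S - T ** Q"
  have QQ: "Q ** transpose Q = mat 1" using Q(1) by (simp add: orthogonal_matrix_def)
  have MM: "?M ** transpose ?M = S ** S + T ** T - S ** transpose Q ** T - T ** Q ** S"
  proof -
    have "transpose ?M = S - transpose Q ** T"
      by (simp add: transpose_diff sym matrix_transpose_mul)
    moreover have "T ** Q ** (transpose Q ** T) = T ** T"
      by (metis QQ matrix_mul_assoc matrix_mul_rid)
    ultimately show ?thesis by (simp add: matrix_mult_diff_right matrix_mult_diff_left matrix_mul_assoc)
  qed
  have t1: "trace (J ** (T ** Q ** S)) = trace (Q ** (S ** J ** T))"
    using trace_mul_sym[of "J ** T" "Q ** S"] by (simp add: matrix_mul_assoc)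
  have "trace (J ** (S ** transpose Q ** T)) = trace (transpose (J ** (S ** transpose Q ** T)))"
    by (simp only: trace_transpose)
  also have "\<dots> = trace (T ** Q ** S ** J)" by (simp add: matrix_transpose_mul sym symJ matrix_mul_assoc)
  also have "\<dots> = trace (J ** (T ** Q ** S))" by (rule trace_mul_sym)
  finally have t2: "trace (J ** (S ** transpose Q ** T)) = trace (Q ** (S ** J ** T))" using t1 by simp
  have sq: "trace (J ** (X ** X)) = trace (X ** X) - 2 * (norm (X *v e))\<^sup>2" if "transpose X = X" for X
    unfolding trJ power2_norm_eq_inner symmetric_matrix_inner[OF that] matrix_vector_mul_assoc ..
  have "trace (?M ** transpose ?M) - 2 * (norm (transpose ?M *v e))\<^sup>2 = trace (J ** (?M ** transpose ?M))"
    unfolding trJ by (metis dot_lmul_matrix matrix_vector_mul_assoc power2_norm_eq_inner transpose_matrix_vector)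
  also have "\<dots> = trace (J ** (S ** S)) + trace (J ** (T ** T)) - 2 * trace (Q ** (S ** J ** T))"
    unfolding MM by (simp add: matrix_add_ldistrib matrix_mult_diff_right trace_add trace_sub t1 t2)
  also have "\<dots> \<le> 2 * ((real CARD('n) - 1) * L\<^sup>2 - l\<^sup>2) - 2 * (real CARD('n) * (l * l))"
    unfolding sq[OF sym(1)] sq[OF sym(2)]
    using trace_minus_twice_diagonal_le[OF S e] trace_minus_twice_diagonal_le[OF T e] l Q(2) by simp
  finally show thesis using that[OF Q(1)] by (simp add: algebra_simps power2_eq_square)
qed

section \<open>Averages over the unit ball\<close>

abbreviation ball_integrable :: "(real^'n \<Rightarrow> real) \<Rightarrow> bool" where
  "ball_integrable f \<equiv> set_integrable lebesgue (ball 0 1) f"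

definition ball_avg :: "(real^'n \<Rightarrow> real) \<Rightarrow> real" where
  "ball_avg f = (LINT y:ball 0 1|lebesgue. f y) / measure lebesgue (ball 0 1 :: (real^'n) set)"

lemma unit_ball_measure_pos: "0 < measure lebesgue (ball 0 1 :: (real^'n) set)"
  by (simp add: content_ball_pos)

lemma ball_integrable_continuous:
  fixes f :: "real^'n \<Rightarrow> real"
  assumes "continuous_on UNIV f"
  shows "ball_integrable f"
proof -
  obtain a where a: "ball (0::real^'n) 1 \<subseteq> cbox (-a) a"
    using bounded_subset_cbox_symmetric[OF bounded_ball] by blast
  have "set_integrable lebesgue (cbox (-a) a) f"
    using assms by (intro absolutely_integrable_continuous) (rule continuous_on_subset, auto)
  then show ?thesis by (rule set_integrable_subset) (use a in auto)
qed

lemma ball_integrable_const: "ball_integrable (\<lambda>_. c)"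
  by (rule ball_integrable_continuous) simp

lemma ball_avg_const [simp]: "ball_avg (\<lambda>_. c) = c"
  by (simp add: ball_avg_def set_lebesgue_integral_def)

lemma ball_avg_cmult: "ball_avg (\<lambda>y. c * f y) = c * ball_avg f"
  by (simp add: ball_avg_def)

lemma ball_avg_add:
  "ball_integrable f \<Longrightarrow> ball_integrable g \<Longrightarrow> ball_avg (\<lambda>y. f y + g y) = ball_avg f + ball_avg g"
  by (simp add: ball_avg_def set_integral_add add_divide_distrib)

lemma ball_avg_diff:
  "ball_integrable f \<Longrightarrow> ball_integrable g \<Longrightarrow> ball_avg (\<lambda>y. f y - g y) = ball_avg f - ball_avg g"
  by (simp add: ball_avg_def set_integral_diff diff_divide_distrib)

lemma ball_avg_mono:
  assumes "ball_integrable f" "ball_integrable g" "\<And>y. norm y < 1 \<Longrightarrow> f y \<le> g y"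
  shows "ball_avg f \<le> ball_avg g"
  unfolding ball_avg_def
  by (intro divide_right_mono set_integral_mono assms) auto

lemma ball_avg_sum:
  assumes "finite I" "\<And>i. i \<in> I \<Longrightarrow> ball_integrable (f i)"
  shows "ball_avg (\<lambda>y. \<Sum>i\<in>I. f i y) = (\<Sum>i\<in>I. ball_avg (f i)) \<and> ball_integrable (\<lambda>y. \<Sum>i\<in>I. f i y)"
  using assms by (induction rule: finite_induct) (auto simp: ball_avg_add ball_integrable_const)

lemma ball_avg_orthogonal:
  fixes Q :: "real^'n^'n"
  assumes Q: "orthogonal_matrix Q" and f: "ball_integrable f"
  shows "ball_avg (\<lambda>y. f (Q *v y)) = ball_avg f"
proof -
  have det: "\<bar>det Q\<bar> = 1" using det_orthogonal_matrix[OF Q] by auto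
  then have "det Q \<noteq> 0" by auto
  have "orthogonal_transformation ((*v) Q)" using Q by (simp add: orthogonal_transformation_matrix)
  then have im: "(\<lambda>y. 0 + Q *v y) ` ball 0 1 = ball 0 1"
    using image_orthogonal_transformation_ball[of "(*v) Q" 0 1] by simp
  show "ball_avg (\<lambda>y. f (Q *v y)) = ball_avg f"
    using set_integral_affine_matrix[OF \<open>det Q \<noteq> 0\<close>, of 0 "ball 0 1" f] f im det by (simp add: ball_avg_def)
qed

lemma orthogonal_matrix_minus_id: "orthogonal_matrix (- mat 1 :: real^'n^'n)"
proof -
  have "transpose (- mat 1 :: real^'n^'n) = - mat 1" by (auto simp: transpose_def mat_def vec_eq_iff)
  moreover have "(- mat 1 :: real^'n^'n) ** (- mat 1) = mat 1"
    by (simp add: matrix_matrix_mult_def mat_def vec_eq_iff if_distrib[of "\<lambda>x. x * y" for y] sum.delta cong: if_cong)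
  ultimately show ?thesis by (simp add: orthogonal_matrix)
qed

lemma minus_id_mult_vec [simp]: "(- mat 1 :: real^'n^'n) *v y = - y"
  by (simp add: matrix_vector_mult_def mat_def vec_eq_iff if_distrib[of "\<lambda>x. x * y" for y] sum_negf cong: if_cong)

lemma ball_avg_linear: "ball_avg (\<lambda>y. v \<bullet> y) = 0"
proof -
  have "ball_integrable (\<lambda>y. v \<bullet> y)" by (intro ball_integrable_continuous continuous_intros)
  from ball_avg_orthogonal[OF orthogonal_matrix_minus_id this]
  have "ball_avg (\<lambda>y. (-1) * (v \<bullet> y)) = ball_avg (\<lambda>y. v \<bullet> y)" by simp
  then show ?thesis unfolding ball_avg_cmult by simp
qed

text \<open>
  The sub-ball carries the fraction \<open>\<rho>\<^sup>n\<close> of the unit ball.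
\<close>

lemma ball_avg_ge_on_subball:
  fixes f :: "real^'n \<Rightarrow> real"
  assumes f: "ball_integrable f" "\<And>y. 0 \<le> f y" and sub: "ball y0 \<rho> \<subseteq> ball 0 1" and \<rho>: "0 < \<rho>"
    and c: "\<And>y. y \<in> ball y0 \<rho> \<Longrightarrow> c \<le> f y"
  shows "c * \<rho> ^ CARD('n) \<le> ball_avg f"
proof -
  let ?V = "measure lebesgue (ball 0 1 :: (real^'n) set)"
  have int: "set_integrable lebesgue (ball y0 \<rho>) f" using f(1) by (rule set_integrable_subset) (use sub in auto)
  have "c * (\<rho> ^ CARD('n) * ?V) = (LINT y:ball y0 \<rho>|lebesgue. c)"
    using content_ball_conv_unit_ball[of \<rho> y0] \<rho> by (simp add: set_lebesgue_integral_def)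
  also have "\<dots> \<le> (LINT y:ball y0 \<rho>|lebesgue. f y)"
    using sub by (intro set_integral_mono int c set_integrable_subset[OF ball_integrable_const]) auto
  also have "\<dots> \<le> (LINT y:ball 0 1|lebesgue. f y)"
    using int f sub unfolding set_lebesgue_integral_def set_integrable_def
    by (intro integral_mono) (auto simp: indicator_def)
  finally show ?thesis
    using unit_ball_measure_pos[where 'n='n] by (simp add: ball_avg_def pos_le_divide_eq mult_ac)
qed

text \<open>
  The unit ball is isotropic: rotating \<open>v\<close> onto a coordinate axis shows that its second moment in
  direction \<open>v\<close> is a multiple of \<open>|v|\<^sup>2\<close>. The factor \<open>\<sigma>\<close> is positive because of the contribution of a
  small ball centred on that axis.
\<close>

theorem ball_second_moment:
  obtains \<sigma> where "0 < \<sigma>" "\<And>v :: real^'n. ball_avg (\<lambda>y. (v \<bullet> y)\<^sup>2) = \<sigma> * (norm v)\<^sup>2"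
proof -
  obtain k :: 'n where True by simp
  let ?e = "axis k 1 :: real^'n"
  define \<sigma> where "\<sigma> = ball_avg (\<lambda>y. (?e \<bullet> y)\<^sup>2)"
  have int: "ball_integrable (\<lambda>y. (v \<bullet> y)\<^sup>2)" for v :: "real^'n"
    by (intro ball_integrable_continuous continuous_intros)
  have eq: "ball_avg (\<lambda>y. (v \<bullet> y)\<^sup>2) = \<sigma> * (norm v)\<^sup>2" for v :: "real^'n"
  proof (cases "v = 0")
    case False
    then have "norm ((1 / norm v) *\<^sub>R v) = 1" by simp
    then obtain R where R: "orthogonal_matrix R" "R *v ?e = (1 / norm v) *\<^sub>R v"
      using orthogonal_matrix_exists_basis by blast
    have v: "v = norm v *\<^sub>R (R *v ?e)" using False by (simp add: R(2))
    have RR: "transpose R ** R = mat 1" using R(1) by (simp add: orthogonal_matrix_def)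
    have "(R *v ?e) \<bullet> (R *v y) = ?e \<bullet> y" for y
      using R(1) orthogonal_transformation_def orthogonal_transformation_matrix
      by (metis matrix_of_matrix_vector_mul matrix_vector_mul_linear)
    then have "(v \<bullet> (R *v y))\<^sup>2 = (norm v)\<^sup>2 * (?e \<bullet> y)\<^sup>2" for y
      by (subst v) (simp add: power_mult_distrib)
    then show ?thesis
      using ball_avg_orthogonal[OF R(1) int, of v] by (simp add: ball_avg_cmult \<sigma>_def mult.commute)
  qed simp
  have "(1/16) * (1/4) ^ CARD('n) \<le> \<sigma>" unfolding \<sigma>_def
  proof (rule ball_avg_ge_on_subball[OF int, where ?y0.0="(1/2) *\<^sub>R ?e" and \<rho>="1/4"])
    fix y assume "y \<in> ball ((1/2) *\<^sub>R ?e) (1/4)"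
    then have y: "norm (y - (1/2) *\<^sub>R ?e) < 1/4" by (simp add: dist_norm norm_minus_commute)
    have "\<bar>?e \<bullet> (y - (1/2) *\<^sub>R ?e)\<bar> < 1/4"
      using Cauchy_Schwarz_ineq2[of ?e "y - (1/2) *\<^sub>R ?e"] y by simp
    moreover have "?e \<bullet> (y - (1/2) *\<^sub>R ?e) = ?e \<bullet> y - 1/2" by (simp add: inner_diff_right inner_axis_axis)
    ultimately have "1/4 \<le> ?e \<bullet> y" by linarith
    then have "(1/4)\<^sup>2 \<le> (?e \<bullet> y)\<^sup>2" by (intro power_mono) auto
    then show "1/16 \<le> (?e \<bullet> y)\<^sup>2" by (simp add: power2_eq_square)
  qed (auto simp: ball_subset_ball_iff)
  moreover have "0 < (1/16) * (1/4 :: real) ^ CARD('n)" by simp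
  ultimately have "0 < \<sigma>" by linarith
  with eq show thesis using that by blast
qed

lemma norm_matrix_vec_square:
  fixes M :: "real^'n^'n"
  shows "(norm (M *v y))\<^sup>2 = (\<Sum>i\<in>UNIV. (row i M \<bullet> y)\<^sup>2)"
  by (subst power2_norm_eq_inner) (simp add: inner_vec_def matrix_vector_mult_def row_def power2_eq_square)

lemma trace_mult_transpose:
  fixes M :: "real^'n^'n"
  shows "trace (M ** transpose M) = (\<Sum>i\<in>UNIV. (norm (row i M))\<^sup>2)"
  by (simp add: trace_def matrix_matrix_mult_def transpose_def power2_norm_eq_inner inner_vec_def row_def)

lemma ball_avg_norm_square:
  fixes M :: "real^'n^'n"
  assumes \<sigma>: "\<And>v :: real^'n. ball_avg (\<lambda>y. (v \<bullet> y)\<^sup>2) = \<sigma> * (norm v)\<^sup>2"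
  shows "ball_avg (\<lambda>y. (norm (M *v y))\<^sup>2) = \<sigma> * trace (M ** transpose M)"
proof -
  have "ball_avg (\<lambda>y. \<Sum>i\<in>UNIV. (row i M \<bullet> y)\<^sup>2) = (\<Sum>i\<in>UNIV. ball_avg (\<lambda>y. (row i M \<bullet> y)\<^sup>2))"
    by (rule ball_avg_sum[THEN conjunct1]) (auto intro!: ball_integrable_continuous continuous_intros)
  then show ?thesis by (simp add: norm_matrix_vec_square \<sigma> trace_mult_transpose sum_distrib_left)
qed

lemma ball_avg_inner_square:
  fixes M :: "real^'n^'n"
  assumes \<sigma>: "\<And>v :: real^'n. ball_avg (\<lambda>y. (v \<bullet> y)\<^sup>2) = \<sigma> * (norm v)\<^sup>2"
  shows "ball_avg (\<lambda>y. (v \<bullet> (M *v y))\<^sup>2) = \<sigma> * (norm (transpose M *v v))\<^sup>2"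
  using \<sigma>[of "transpose M *v v"] by (simp add: dot_lmul_matrix)

section \<open>Expansion of powers of the distance\<close>

text \<open>
  Taylor expansion to third order. The third derivative is positive and decreasing. So the remainder
  is negative for \<open>\<xi> < 0\<close>, which makes the bound uniform up to the singularity at \<open>\<xi> = -1\<close>; and for
  \<open>\<xi> > 0\<close> it is controlled by the third derivative at the origin.
\<close>

lemma powr_one_plus_upper:
  fixes \<beta> \<xi> :: real
  assumes \<beta>: "0 < \<beta>" "\<beta> < 1" and \<xi>: "-1 < \<xi>"
  shows "(1 + \<xi>) powr \<beta> \<le> 1 + \<beta> * \<xi> - \<beta> * (1 - \<beta>) / 2 * \<xi>\<^sup>2 + \<beta> / 3 * \<bar>\<xi>\<bar> ^ 3"
proof (cases "\<xi> = 0")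
  case False
  define D :: "nat \<Rightarrow> real \<Rightarrow> real" where
    "D m x = (\<Prod>i<m. \<beta> - real i) * (1 + x) powr (\<beta> - real m)" for m x
  have deriv: "(D m has_real_derivative D (Suc m) x) (at x)" if "-1 < x" for m x
  proof -
    have "((\<lambda>x. (1 + x) powr (\<beta> - real m)) has_real_derivative
        (\<beta> - real m) * (1 + x) powr (\<beta> - real m - 1)) (at x)"
      using that by (auto intro!: derivative_eq_intros)
    from DERIV_cmult[OF this, of "\<Prod>i<m. \<beta> - real i"] show ?thesis
      by (simp add: D_def[abs_def] mult.assoc algebra_simps)
  qed
  have "\<exists>t. (if \<xi> < 0 then \<xi> < t \<and> t < 0 else 0 < t \<and> t < \<xi>) \<and>
      D 0 \<xi> = (\<Sum>m<3. (D m 0 / fact m) * (\<xi> - 0) ^ m) + (D 3 t / fact 3) * (\<xi> - 0) ^ 3"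
    by (rule Taylor[where a="min \<xi> 0" and b="max \<xi> 0"]) (use \<xi> False in \<open>auto intro!: deriv\<close>)
  then obtain t where t: "if \<xi> < 0 then \<xi> < t \<and> t < 0 else 0 < t \<and> t < \<xi>"
    and eq: "D 0 \<xi> = (\<Sum>m<3. (D m 0 / fact m) * \<xi> ^ m) + (D 3 t / fact 3) * \<xi> ^ 3" by auto
  have D3: "D 3 t = \<beta> * (1 - \<beta>) * (2 - \<beta>) * (1 + t) powr (\<beta> - 3)"
    by (simp add: D_def numeral_3_eq_3 algebra_simps)
  have eq': "(1 + \<xi>) powr \<beta> = 1 + \<beta> * \<xi> - \<beta> * (1 - \<beta>) / 2 * \<xi>\<^sup>2 + D 3 t / 6 * \<xi> ^ 3"
  proof -
    have "D 0 \<xi> = (1 + \<xi>) powr \<beta>" by (simp add: D_def)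
    moreover have "(\<Sum>m<3. (D m 0 / fact m) * \<xi> ^ m) = 1 + \<beta> * \<xi> - \<beta> * (1 - \<beta>) / 2 * \<xi>\<^sup>2"
      by (simp add: D_def numeral_3_eq_3 power2_eq_square field_simps)
    moreover have "fact 3 = (6::real)" by (simp add: fact_numeral)
    ultimately show ?thesis using eq by simp
  qed
  have "D 3 t / 6 * \<xi> ^ 3 \<le> \<beta> / 3 * \<bar>\<xi>\<bar> ^ 3"
  proof (cases "\<xi> < 0")
    case True
    have "0 \<le> D 3 t" using \<beta> by (simp add: D3)
    moreover have "\<xi> ^ 3 \<le> 0" using True by (simp add: power3_eq_cube mult_nonneg_nonpos2 mult_nonneg_nonpos mult_nonpos_nonpos)
    ultimately have "D 3 t / 6 * \<xi> ^ 3 \<le> 0" by (simp add: mult_nonneg_nonpos)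
    then show ?thesis using \<beta> by (smt (verit) divide_nonneg_nonneg mult_nonneg_nonneg zero_le_power abs_ge_zero)
  next
    case False
    then have "0 < t" using t by auto
    then have "(1 + t) powr (\<beta> - 3) \<le> 1"
      using \<beta> powr_mono2'[of "\<beta> - 3" 1 "1 + t"] by simp
    moreover have "(1 - \<beta>) * (2 - \<beta>) \<le> 1 * 2" using \<beta> by (intro mult_mono) auto
    ultimately have "(1 - \<beta>) * (2 - \<beta>) * (1 + t) powr (\<beta> - 3) \<le> 2 * 1"
      using \<beta> by (intro mult_mono) auto
    then have "\<beta> * ((1 - \<beta>) * (2 - \<beta>) * (1 + t) powr (\<beta> - 3)) \<le> \<beta> * 2" using \<beta> by (intro mult_left_mono) auto
    then have "D 3 t / 6 \<le> \<beta> / 3" by (simp add: D3 mult.assoc)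
    then have "D 3 t / 6 * \<xi> ^ 3 \<le> \<beta> / 3 * \<xi> ^ 3" using False by (intro mult_right_mono) auto
    then show ?thesis using False by simp
  qed
  then show ?thesis using eq' by simp
qed simp

text \<open>
  Second-order expansion of \<open>|d + h|\<^sup>\<alpha> = |d|\<^sup>\<alpha> (1 + \<xi>)\<^sup>\<alpha>\<^sup>/\<^sup>2\<close> with \<open>\<xi> = (2 d \<bullet> h + |h|\<^sup>2) / |d|\<^sup>2\<close>. The
  component of \<open>h\<close> along \<open>d\<close> enters the quadratic part with the factor \<open>1 - (2 - \<alpha>) < 0\<close>, the other
  components with the factor \<open>1\<close>; so the average decreases when the increment fluctuates mainly along
  \<open>d\<close>, which is what the reflection coupling achieves.
\<close>

lemma norm_powr_second_order:
  fixes d h :: "'a::real_inner"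
  assumes \<alpha>: "0 < \<alpha>" "\<alpha> < 1" and h: "norm h \<le> H" and H: "4 * H \<le> norm d" and d: "d \<noteq> 0"
  defines "t \<equiv> norm d"
  shows "norm (d + h) powr \<alpha> \<le> t powr \<alpha> + \<alpha> / 2 * t powr (\<alpha> - 2) *
     (2 * (d \<bullet> h) + (norm h)\<^sup>2 - (2 - \<alpha>) * (((1 / t) *\<^sub>R d) \<bullet> h)\<^sup>2 + 11 * H ^ 3 / t)"
proof -
  have t: "0 < t" using d by (simp add: t_def)
  have H0: "0 \<le> H" using h norm_ge_zero[of h] by linarith
  define r where "r = H / t"
  define p where "p = (d \<bullet> h) / t\<^sup>2"
  define q where "q = (norm h)\<^sup>2 / t\<^sup>2"
  define \<xi> where "\<xi> = 2 * p + q"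
  have r: "0 \<le> r" "r \<le> 1/4" using H H0 t by (simp_all add: r_def t_def field_simps)
  have "\<bar>d \<bullet> h\<bar> \<le> t * H" using Cauchy_Schwarz_ineq2[of d h] h t
    by (smt (verit) mult_left_mono t_def)
  then have p: "\<bar>p\<bar> \<le> r" using t by (simp add: p_def r_def field_simps power2_eq_square)
  have "(norm h)\<^sup>2 \<le> H\<^sup>2" using h by (intro power_mono) auto
  then have q: "0 \<le> q" "q \<le> r\<^sup>2" using t by (simp_all add: q_def r_def divide_right_mono power_divide)
  have r2: "r\<^sup>2 \<le> r" using r by (simp add: power2_eq_square mult_left_le_one_le)
  have \<xi>: "\<bar>\<xi>\<bar> \<le> 3 * r" using p q r2 unfolding \<xi>_def by linarith
  then have \<xi>1: "-1 < \<xi>" using r by linarith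
  have "(norm (d + h))\<^sup>2 = t\<^sup>2 * (1 + \<xi>)"
    using t unfolding \<xi>_def p_def q_def t_def
    by (simp add: power2_norm_eq_inner inner_add_left inner_add_right inner_commute field_simps)
  moreover have "norm (d + h) powr \<alpha> = ((norm (d + h))\<^sup>2) powr (\<alpha> / 2)"
    by (cases "d + h = 0") (simp_all add: powr_powr flip: powr_numeral)
  ultimately have eq: "norm (d + h) powr \<alpha> = t powr \<alpha> * (1 + \<xi>) powr (\<alpha> / 2)"
    using t \<xi>1 by (simp add: powr_mult powr_powr flip: powr_numeral)
  define \<beta> where "\<beta> = \<alpha> / 2"
  have \<beta>: "0 < \<beta>" "\<beta> < 1" using \<alpha> by (simp_all add: \<beta>_def)
  have "(1 + \<xi>) powr \<beta> \<le> 1 + \<beta> * \<xi> - \<beta> * (1 - \<beta>) / 2 * \<xi>\<^sup>2 + \<beta> / 3 * \<bar>\<xi>\<bar> ^ 3"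
    by (rule powr_one_plus_upper[OF \<beta> \<xi>1])
  also have "\<dots> \<le> 1 + \<beta> * \<xi> - \<beta> * (1 - \<beta>) / 2 * (4 * p\<^sup>2 - 4 * r ^ 3) + \<beta> / 3 * (27 * r ^ 3)"
  proof -
    have "4 * p\<^sup>2 - 4 * r ^ 3 \<le> \<xi>\<^sup>2"
    proof -
      have "\<bar>p * q\<bar> \<le> r * r\<^sup>2" unfolding abs_mult using p q r by (intro mult_mono) auto
      then have "- (r ^ 3) \<le> p * q" by (simp add: power3_eq_cube power2_eq_square mult.assoc)
      then show ?thesis unfolding \<xi>_def using zero_le_power2[of q]
        by (simp add: power2_eq_square algebra_simps)
    qed
    moreover have "0 \<le> \<beta> * (1 - \<beta>) / 2" using \<beta> by simp
    ultimately have "\<beta> * (1 - \<beta>) / 2 * (4 * p\<^sup>2 - 4 * r ^ 3) \<le> \<beta> * (1 - \<beta>) / 2 * \<xi>\<^sup>2"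
      by (rule mult_left_mono)
    moreover have "\<bar>\<xi>\<bar> ^ 3 \<le> (3 * r) ^ 3" using \<xi> by (intro power_mono) auto
    then have "\<beta> / 3 * \<bar>\<xi>\<bar> ^ 3 \<le> \<beta> / 3 * (27 * r ^ 3)"
      using \<beta> by (intro mult_left_mono) (simp_all add: power_mult_distrib)
    ultimately show ?thesis by linarith
  qed
  also have "\<dots> \<le> 1 + \<beta> * (2 * p + q - 2 * (1 - \<beta>) * p\<^sup>2 + 11 * r ^ 3)"
  proof -
    have "\<beta> * (1 - \<beta>) * (2 * r ^ 3) \<le> \<beta> * (2 * r ^ 3)" using \<beta> r by (intro mult_right_mono) (auto simp: mult_left_le)
    moreover have "\<beta> * (1 - \<beta>) / 2 * (4 * p\<^sup>2 - 4 * r ^ 3) = \<beta> * (2 * (1 - \<beta>) * p\<^sup>2) - \<beta> * (1 - \<beta>) * (2 * r ^ 3)"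
      by (simp add: field_simps)
    moreover have "\<beta> * (2 * p + q - 2 * (1 - \<beta>) * p\<^sup>2 + 11 * r ^ 3)
        = \<beta> * \<xi> - \<beta> * (2 * (1 - \<beta>) * p\<^sup>2) + 11 * (\<beta> * r ^ 3)"
      by (simp add: \<xi>_def algebra_simps)
    ultimately show ?thesis by linarith
  qed
  finally have "t powr \<alpha> * (1 + \<xi>) powr \<beta> \<le> t powr \<alpha> * (1 + \<beta> * (2 * p + q - 2 * (1 - \<beta>) * p\<^sup>2 + 11 * r ^ 3))"
    by (intro mult_left_mono) auto
  also have "\<dots> = t powr \<alpha> + \<beta> * t powr (\<alpha> - 2) * (t\<^sup>2 * (2 * p + q - 2 * (1 - \<beta>) * p\<^sup>2 + 11 * r ^ 3))"
    using t by (simp add: powr_diff field_simps)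
  also have "t\<^sup>2 * (2 * p + q - 2 * (1 - \<beta>) * p\<^sup>2 + 11 * r ^ 3) =
      2 * (d \<bullet> h) + (norm h)\<^sup>2 - (2 - \<alpha>) * (((1 / t) *\<^sub>R d) \<bullet> h)\<^sup>2 + 11 * H ^ 3 / t"
  proof -
    have "t\<^sup>2 * p = d \<bullet> h" "t\<^sup>2 * q = (norm h)\<^sup>2" "t\<^sup>2 * p\<^sup>2 = (((1 / t) *\<^sub>R d) \<bullet> h)\<^sup>2" "t\<^sup>2 * r ^ 3 = H ^ 3 / t"
      using t by (simp_all add: p_def q_def r_def power_divide power2_eq_square power3_eq_cube)
    then have "t\<^sup>2 * (2 * p + q - 2 * (1 - \<beta>) * p\<^sup>2 + 11 * r ^ 3)
       = 2 * (d \<bullet> h) + (norm h)\<^sup>2 - 2 * (1 - \<beta>) * (((1 / t) *\<^sub>R d) \<bullet> h)\<^sup>2 + 11 * (H ^ 3 / t)"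
      by (simp add: algebra_simps)
    then show ?thesis by (simp add: \<beta>_def)
  qed
  finally show ?thesis unfolding eq \<beta>_def .
qed

lemma powr_decrease:
  fixes \<alpha> \<kappa> t N :: real
  assumes \<alpha>: "0 < \<alpha>" "\<alpha> < 1" and k: "0 < \<kappa>" "\<kappa> < t" "t \<le> N" and b: "0 \<le> b" "b \<le> t - \<kappa>"
  shows "b powr \<alpha> \<le> t powr \<alpha> - \<alpha> * \<kappa> * N powr (\<alpha> - 1)"
proof -
  have "\<exists>z>t - \<kappa>. z < t \<and> t powr \<alpha> - (t - \<kappa>) powr \<alpha> = (t - (t - \<kappa>)) * (\<alpha> * z powr (\<alpha> - 1))"
    by (rule MVT2) (use k in \<open>auto intro!: derivative_eq_intros\<close>)
  then obtain z where z: "t - \<kappa> < z" "z < t" "t powr \<alpha> - (t - \<kappa>) powr \<alpha> = \<kappa> * (\<alpha> * z powr (\<alpha> - 1))" by auto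
  have "N powr (\<alpha> - 1) \<le> z powr (\<alpha> - 1)" using z k \<alpha> by (intro powr_mono2') auto
  then have "\<kappa> * (\<alpha> * N powr (\<alpha> - 1)) \<le> \<kappa> * (\<alpha> * z powr (\<alpha> - 1))" using k \<alpha> by (intro mult_left_mono) auto
  moreover have "b powr \<alpha> \<le> (t - \<kappa>) powr \<alpha>" using b \<alpha> by (intro powr_mono2) auto
  ultimately show ?thesis using z(3) by (simp add: mult_ac)
qed

section \<open>Contraction of the distance under coupling\<close>

text \<open>
  The profile is evaluated at \<open>\<tau> = (|x - z| / \<epsilon>)\<^sup>\<alpha>\<close>. The exponential handles distances of the order of
  \<open>\<epsilon>\<close>, where the expansion of \<open>|x - z|\<^sup>\<alpha>\<close> fails: if \<open>\<tau>\<close> drops by \<open>k\<close> with probability \<open>p\<close>, the average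
  of \<open>exp (- s \<tau>)\<close> grows at least by the factor \<open>p exp (s k)\<close>, large when \<open>s\<close> is. The exponential is
  taken of \<open>\<tau>\<close> and not of the distance so that the profile is an increasing concave function of \<open>\<tau>\<close>:
  a decrease of the average of \<open>\<tau>\<close> is then inherited by the profile.
\<close>

definition profile :: "real \<Rightarrow> real \<Rightarrow> real \<Rightarrow> real" where
  "profile s b \<tau> = \<tau> - b * exp (- (s * \<tau>))"

lemma profile_tangent:
  assumes "0 \<le> b"
  shows "profile s b X \<le> profile s b \<tau> + (1 + b * s * exp (- (s * \<tau>))) * (X - \<tau>)"
proof -
  have "exp (- (s * \<tau>)) * (1 - s * (X - \<tau>)) \<le> exp (- (s * \<tau>)) * exp (- (s * (X - \<tau>)))"
    using exp_ge_add_one_self[of "- (s * (X - \<tau>))"] by (intro mult_left_mono) auto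
  also have "\<dots> = exp (- (s * X))" by (simp add: algebra_simps flip: exp_add)
  finally have "b * (exp (- (s * \<tau>)) * (1 - s * (X - \<tau>))) \<le> b * exp (- (s * X))"
    using assms by (rule mult_left_mono)
  then show ?thesis by (simp add: profile_def algebra_simps)
qed

lemma continuous_on_profile_dist:
  fixes M :: "real^'n^'n"
  assumes "0 < \<alpha>"
  shows "continuous_on UNIV (\<lambda>y. norm (d + M *v y) powr \<alpha>)"
    and "continuous_on UNIV (\<lambda>y. profile s b (norm (d + M *v y) powr \<alpha>))"
proof -
  show c: "continuous_on UNIV (\<lambda>y. norm (d + M *v y) powr \<alpha>)"
    using assms by (intro continuous_on_powr' continuous_intros matrix_vector_mult_linear_continuous_on) auto
  show "continuous_on UNIV (\<lambda>y. profile s b (norm (d + M *v y) powr \<alpha>))"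
    unfolding profile_def by (intro continuous_intros c)
qed

lemma norm_orthogonal_matrix_vec:
  fixes Q :: "real^'n^'n"
  assumes "orthogonal_matrix Q"
  shows "norm (Q *v y) = norm y"
  using assms by (metis matrix_of_matrix_vector_mul matrix_vector_mul_linear
      orthogonal_transformation orthogonal_transformation_matrix)

lemma norm_coupled_step_le:
  assumes S: "pinched l L S" and T: "pinched l L T" and Q: "orthogonal_matrix Q"
  shows "norm ((S - T ** Q) *v y) \<le> 2 * L * norm y"
proof -
  have "norm ((S - T ** Q) *v y) \<le> norm (S *v y) + norm (T *v (Q *v y))"
    by (simp add: matrix_vector_mult_diff_rdistrib norm_triangle_ineq4 flip: matrix_vector_mul_assoc)
  also have "\<dots> \<le> L * norm y + L * norm (Q *v y)"
    using S T unfolding pinched_def by (intro add_mono) auto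
  finally show ?thesis by (simp add: norm_orthogonal_matrix_vec[OF Q])
qed

lemma norm_coupled_transpose_le:
  fixes S T Q :: "real^'n^'n"
  assumes S: "pinched l L S" and T: "pinched l L T" and Q: "orthogonal_matrix Q"
  shows "norm (transpose (S - T ** Q) *v e) \<le> 2 * L * norm e"
proof -
  have sym: "transpose S = S" "transpose T = T" using S T by (auto simp: pinched_def)
  have "transpose (S - T ** Q) = S - transpose Q ** T"
    by (simp add: transpose_diff sym matrix_transpose_mul)
  then have "norm (transpose (S - T ** Q) *v e) \<le> norm (S *v e) + norm (transpose Q *v (T *v e))"
    by (simp add: matrix_vector_mult_diff_rdistrib norm_triangle_ineq4 del: transpose_matrix_vector flip: matrix_vector_mul_assoc)
  also have "norm (transpose Q *v (T *v e)) = norm (T *v e)"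
    by (rule norm_orthogonal_matrix_vec) (use Q in simp)
  also have "norm (S *v e) + norm (T *v e) \<le> L * norm e + L * norm e"
    using S T unfolding pinched_def by (intro add_mono) auto
  finally show ?thesis by simp
qed

text \<open>
  At distances beyond a large multiple of the step size, the average of \<open>norm_powr_second_order\<close> under
  the reflection coupling leaves the quadratic part \<open>\<sigma> (tr (M M\<^sup>T) - (2 - \<alpha>) |M\<^sup>T e|\<^sup>2)\<close>, at most \<open>- \<sigma> \<gamma>\<close>:
  with \<open>2\<close> in place of \<open>2 - \<alpha>\<close> the bracket is at most \<open>- 2 \<gamma>\<close>, and a small \<open>\<alpha>\<close> costs at most
  \<open>\<gamma>\<close>. Half of the remaining \<open>\<sigma> \<gamma>\<close> absorbs the cubic error.
\<close>

lemma far_contraction: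
  fixes S T :: "real^'n^'n" and d :: "real^'n"
  assumes S: "pinched l L S" and T: "pinched l L T" and l: "0 < l" "l \<le> L"
    and \<sigma>: "0 < \<sigma>" "\<And>v :: real^'n. ball_avg (\<lambda>y. (v \<bullet> y)\<^sup>2) = \<sigma> * (norm v)\<^sup>2"
    and \<alpha>: "0 < \<alpha>" "\<alpha> < 1" "\<alpha> * (4 * L\<^sup>2) \<le> \<gamma>"
    and \<gamma>: "0 < \<gamma>" "\<gamma> \<le> (real CARD('n) + 1) * l\<^sup>2 - (real CARD('n) - 1) * L\<^sup>2"
    and d: "8 * L \<le> norm d" "22 * (2 * L) ^ 3 / (\<sigma> * \<gamma>) \<le> norm d"
  obtains Q where "orthogonal_matrix Q"
    "ball_avg (\<lambda>y. norm (d + (S - T ** Q) *v y) powr \<alpha>)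
      \<le> norm d powr \<alpha> - \<alpha> * \<sigma> * \<gamma> / 4 * norm d powr (\<alpha> - 2)"
proof -
  define t where "t = norm d"
  have t: "0 < t" using d l by (auto simp: t_def)
  define e where "e = (1 / t) *\<^sub>R d"
  have e: "norm e = 1" using t by (auto simp: e_def t_def)
  obtain Q where Q: "orthogonal_matrix Q"
    and tr: "trace ((S - T ** Q) ** transpose (S - T ** Q)) - 2 * (norm (transpose (S - T ** Q) *v e))\<^sup>2
       \<le> 2 * ((real CARD('n) - 1) * L\<^sup>2 - (real CARD('n) + 1) * l\<^sup>2)"
    using reflection_coupling[OF S T l(1) e] by blast
  define M where "M = S - T ** Q"
  define D where "D = 11 * (2 * L) ^ 3 / t"
  define F where "F y = 2 * (d \<bullet> (M *v y)) + (norm (M *v y))\<^sup>2 - (2 - \<alpha>) * (e \<bullet> (M *v y))\<^sup>2 + D" for y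
  have int: "ball_integrable (\<lambda>y. d \<bullet> (M *v y))" "ball_integrable (\<lambda>y. (norm (M *v y))\<^sup>2)"
      "ball_integrable (\<lambda>y. (e \<bullet> (M *v y))\<^sup>2)"
    by (intro ball_integrable_continuous continuous_intros matrix_vector_mult_linear_continuous_on)+
  have "ball_avg (\<lambda>y. norm (d + M *v y) powr \<alpha>) \<le> ball_avg (\<lambda>y. t powr \<alpha> + \<alpha> / 2 * t powr (\<alpha> - 2) * F y)"
  proof (rule ball_avg_mono)
    show "ball_integrable (\<lambda>y. norm (d + M *v y) powr \<alpha>)"
      by (intro ball_integrable_continuous continuous_on_profile_dist \<alpha>)
    show "ball_integrable (\<lambda>y. t powr \<alpha> + \<alpha> / 2 * t powr (\<alpha> - 2) * F y)" unfolding F_def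
      by (intro ball_integrable_continuous continuous_intros matrix_vector_mult_linear_continuous_on)
    fix y :: "real^'n" assume y: "norm y < 1"
    have "norm (M *v y) \<le> 2 * L * norm y" unfolding M_def by (rule norm_coupled_step_le[OF S T Q])
    also have "\<dots> \<le> 2 * L * 1" using y l by (intro mult_left_mono) auto
    finally have "norm (M *v y) \<le> 2 * L" by simp
    then show "norm (d + M *v y) powr \<alpha> \<le> t powr \<alpha> + \<alpha> / 2 * t powr (\<alpha> - 2) * F y"
      using norm_powr_second_order[OF \<alpha>(1,2), of "M *v y" "2 * L" d] d(1) t
      by (simp add: F_def D_def e_def t_def)
  qed
  also have "\<dots> = t powr \<alpha> + \<alpha> / 2 * t powr (\<alpha> - 2) * ball_avg F"
  proof -
    have "ball_integrable (\<lambda>y. \<alpha> / 2 * t powr (\<alpha> - 2) * F y)" unfolding F_def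
      by (intro ball_integrable_continuous continuous_intros matrix_vector_mult_linear_continuous_on)
    from ball_avg_add[OF ball_integrable_const this] show ?thesis
      by (simp only: ball_avg_const ball_avg_cmult)
  qed
  finally have avg: "ball_avg (\<lambda>y. norm (d + M *v y) powr \<alpha>) \<le> t powr \<alpha> + \<alpha> / 2 * t powr (\<alpha> - 2) * ball_avg F" .
  have "ball_avg F = \<sigma> * (trace (M ** transpose M) - (2 - \<alpha>) * (norm (transpose M *v e))\<^sup>2) + D"
  proof -
    have "ball_avg (\<lambda>y. d \<bullet> (M *v y)) = 0"
      using ball_avg_linear[of "transpose M *v d"] by (simp add: dot_lmul_matrix)
    then have "ball_avg F = \<sigma> * trace (M ** transpose M) - (2 - \<alpha>) * (\<sigma> * (norm (transpose M *v e))\<^sup>2) + D"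
      unfolding F_def
      by (simp add: ball_avg_add ball_avg_diff ball_avg_cmult ball_integrable_const int
           ball_avg_norm_square[OF \<sigma>(2)] ball_avg_inner_square[OF \<sigma>(2)] del: transpose_matrix_vector)
    then show ?thesis by (simp add: algebra_simps del: transpose_matrix_vector)
  qed
  also have "\<dots> \<le> - (\<sigma> * \<gamma> / 2)"
  proof -
    have "(norm (transpose M *v e))\<^sup>2 \<le> (2 * L)\<^sup>2"
      using norm_coupled_transpose_le[OF S T Q, of e] e unfolding M_def
      by (intro power_mono) (auto simp del: transpose_matrix_vector)
    then have "\<alpha> * (norm (transpose M *v e))\<^sup>2 \<le> \<alpha> * (2 * L)\<^sup>2" using \<alpha> by (intro mult_left_mono) auto
    then have "\<alpha> * (norm (transpose M *v e))\<^sup>2 \<le> \<gamma>" using \<alpha>(3) by (simp add: power_mult_distrib del: transpose_matrix_vector)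
    then have "trace (M ** transpose M) - (2 - \<alpha>) * (norm (transpose M *v e))\<^sup>2 \<le> - \<gamma>"
      using tr \<gamma>(2) unfolding M_def[symmetric] by (simp add: algebra_simps del: transpose_matrix_vector)
    then have "\<sigma> * (trace (M ** transpose M) - (2 - \<alpha>) * (norm (transpose M *v e))\<^sup>2) \<le> \<sigma> * (- \<gamma>)"
      using \<sigma>(1) by (intro mult_left_mono) auto
    moreover have "D \<le> \<sigma> * \<gamma> / 2"
    proof -
      have "22 * (2 * L) ^ 3 \<le> t * (\<sigma> * \<gamma>)"
        using d(2) \<sigma>(1) \<gamma>(1) by (simp add: t_def pos_divide_le_eq)
      then show ?thesis using t by (simp add: D_def pos_divide_le_eq mult_ac)
    qed
    ultimately show ?thesis by simp
  qed
  finally have "\<alpha> / 2 * t powr (\<alpha> - 2) * ball_avg F \<le> \<alpha> / 2 * t powr (\<alpha> - 2) * - (\<sigma> * \<gamma> / 2)"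
    using \<alpha> by (intro mult_left_mono) auto
  also have "\<dots> = - (\<alpha> * \<sigma> * \<gamma> / 4 * t powr (\<alpha> - 2))" by simp
  finally have "ball_avg (\<lambda>y. norm (d + M *v y) powr \<alpha>) \<le> t powr \<alpha> - \<alpha> * \<sigma> * \<gamma> / 4 * t powr (\<alpha> - 2)"
    using avg by linarith
  then show thesis using that[OF Q] by (simp only: M_def t_def)
qed

text \<open>
  At distances comparable to the step size, use the antipodal coupling, in which both points are moved
  by \<open>y\<close> and \<open>- y\<close>. The increment is then \<open>(S + T) y\<close> with \<open>S + T\<close> invertible, so a whole ball of
  \<open>y\<close> brings the points closer by a fixed amount, and the exponential part of the profile gains more
  than the power part can lose.
\<close>

lemma near_contraction:
  fixes S T :: "real^'n^'n" and d :: "real^'n"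
  assumes S: "pinched l L S" and T: "pinched l L T" and l: "0 < l" "l \<le> L"
    and \<alpha>: "0 < \<alpha>" "\<alpha> < 1" and d: "l / 2 \<le> norm d" "norm d \<le> N"
  defines "p \<equiv> (l / (8 * L)) ^ CARD('n)"
  defines "k \<equiv> \<alpha> * (l / 4) * N powr (\<alpha> - 1)"
  defines "s \<equiv> ln (2 / p) / k"
  defines "b \<equiv> ((N + 2 * L) powr \<alpha> + 1) * exp (s * N powr \<alpha>)"
  shows "ball_avg (\<lambda>y. profile s b (norm (d + (S - T ** (- mat 1)) *v y) powr \<alpha>))
           \<le> profile s b (norm d powr \<alpha>) - 1"
proof -
  define t where "t = norm d"
  have t: "0 < t" "l / 2 \<le> t" "t \<le> N" using d l by (auto simp: t_def)
  define M where "M = S - T ** (- mat 1)"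
  have Mv: "M *v y = S *v y + T *v y" for y
  proof -
    have "M *v y = S *v y - T *v ((- mat 1) *v y)"
      unfolding M_def by (simp only: matrix_vector_mult_diff_rdistrib matrix_vector_mul_assoc)
    then show ?thesis unfolding minus_id_mult_vec by (simp add: vec.neg)
  qed
  have M: "pinched (2 * l) (2 * L) M"
  proof -
    have "transpose M = M"
    proof -
      have "T ** (- mat 1) = - T" by (simp add: matrix_eq vec.neg flip: matrix_vector_mul_assoc)
         (simp add: matrix_vector_mult_def vec_eq_iff sum_negf)
      then have "M = S + T" by (simp add: M_def)
      then show ?thesis using S T by (simp add: pinched_def transpose_def vec_eq_iff)
    qed
    moreover have "2 * l * (norm v)\<^sup>2 \<le> v \<bullet> (M *v v)" for v
    proof -
      have "l * (norm v)\<^sup>2 \<le> v \<bullet> (S *v v)" "l * (norm v)\<^sup>2 \<le> v \<bullet> (T *v v)" using S T by (auto simp: pinched_def)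
      then show ?thesis by (simp add: Mv inner_add_right)
    qed
    moreover have "norm (M *v v) \<le> 2 * L * norm v" for v
      unfolding M_def by (rule norm_coupled_step_le[OF S T orthogonal_matrix_minus_id])
    ultimately show ?thesis by (simp add: pinched_def)
  qed
  have "det M \<noteq> 0" by (rule pinched_det_nonzero[OF M]) (use l in simp)
  then obtain M' where M': "M ** M' = mat 1" unfolding invertible_det_nz[symmetric] invertible_def by blast
  \<comment> \<open>the displacement that brings the points closer by exactly \<open>l / 2\<close>;
     moving \<open>y\<close> by at most \<open>\<rho>\<close> spoils at most half of this\<close>
  define y0 where "y0 = M' *v (- (l / (2 * t)) *\<^sub>R d)"
  have My0: "M *v y0 = - (l / (2 * t)) *\<^sub>R d" by (simp add: y0_def matrix_vector_mul_assoc M')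
  have "2 * l * norm y0 \<le> l / 2" using pinched_norm_ge[OF M, of y0] t l by (simp add: My0 t_def)
  then have y0: "norm y0 \<le> 1/4" using l by (simp add: field_simps)
  define \<rho> where "\<rho> = l / (8 * L)"
  have \<rho>: "0 < \<rho>" "\<rho> \<le> 1/8" using l by (simp_all add: \<rho>_def field_simps)
  have p: "0 < p" "p < 1" unfolding p_def \<rho>_def[symmetric] using \<rho> by (auto simp: power_less_one_iff)
  have k: "0 < k" using \<alpha> l t by (simp add: k_def)
  have s: "0 < s" using p k by (simp add: s_def field_simps)
  have b: "0 \<le> b" by (simp add: b_def)
  let ?\<tau> = "t powr \<alpha>"
  let ?X = "\<lambda>y. norm (d + M *v y) powr \<alpha>"
  have intX: "ball_integrable ?X" by (intro ball_integrable_continuous continuous_on_profile_dist \<alpha>)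
  have intE: "ball_integrable (\<lambda>y. exp (- (s * ?X y)))"
    by (intro ball_integrable_continuous continuous_intros continuous_on_profile_dist \<alpha>)
  have "2 * exp (- (s * ?\<tau>)) = exp (- (s * (?\<tau> - k))) * p"
  proof -
    have "s * k = ln (2 / p)" using k by (simp add: s_def)
    then have "exp (s * k) = 2 / p" using p by simp
    then show ?thesis using p by (simp add: right_diff_distrib exp_diff exp_minus field_simps)
  qed
  also have "\<dots> = exp (- (s * (?\<tau> - k))) * \<rho> ^ CARD('n)" by (simp add: p_def \<rho>_def)
  also have "\<dots> \<le> ball_avg (\<lambda>y. exp (- (s * ?X y)))"
  proof (rule ball_avg_ge_on_subball[OF intE _ _ \<rho>(1)])
    show "ball y0 \<rho> \<subseteq> ball 0 1" using y0 \<rho> by (auto simp: ball_subset_ball_iff dist_norm)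
    fix y assume "y \<in> ball y0 \<rho>"
    then have y: "norm (y - y0) \<le> \<rho>" by (simp add: dist_norm norm_minus_commute)
    have "d + M *v y = (1 - l / (2 * t)) *\<^sub>R d + M *v (y - y0)"
      by (simp add: matrix_vector_mult_diff_distrib My0 algebra_simps)
    then have "norm (d + M *v y) \<le> norm ((1 - l / (2 * t)) *\<^sub>R d) + norm (M *v (y - y0))"
      using norm_triangle_ineq by metis
    also have "norm ((1 - l / (2 * t)) *\<^sub>R d) = t - l / 2"
      using t by (simp add: t_def[symmetric] abs_of_nonneg field_simps)
    also have "norm (M *v (y - y0)) \<le> 2 * L * \<rho>"
    proof -
      have "norm (M *v (y - y0)) \<le> 2 * L * norm (y - y0)" using M by (simp add: pinched_def)
      also have "\<dots> \<le> 2 * L * \<rho>" using y l by (intro mult_left_mono) auto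
      finally show ?thesis .
    qed
    also have "2 * L * \<rho> = l / 4" using l by (simp add: \<rho>_def)
    finally have "norm (d + M *v y) \<le> t - l / 4" by simp
    then have "?X y \<le> ?\<tau> - k" unfolding k_def
      using l t by (intro powr_decrease[OF \<alpha>]) auto
    then show "exp (- (s * (?\<tau> - k))) \<le> exp (- (s * ?X y))" using s by simp
  qed simp
  finally have E: "2 * exp (- (s * ?\<tau>)) \<le> ball_avg (\<lambda>y. exp (- (s * ?X y)))" .
  have "ball_avg ?X \<le> ball_avg (\<lambda>_ :: real^'n. (N + 2 * L) powr \<alpha>)"
  proof (rule ball_avg_mono[OF intX ball_integrable_const])
    fix y :: "real^'n" assume y: "norm y < 1"
    have "norm (M *v y) \<le> 2 * L * norm y" using M by (simp add: pinched_def)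
    also have "\<dots> \<le> 2 * L * 1" using y l by (intro mult_left_mono) auto
    finally have "norm (d + M *v y) \<le> N + 2 * L" using norm_triangle_ineq[of d "M *v y"] d by simp
    then show "?X y \<le> (N + 2 * L) powr \<alpha>" using \<alpha> by (intro powr_mono2) auto
  qed
  then have X: "ball_avg ?X \<le> (N + 2 * L) powr \<alpha>" by simp
  have be: "((N + 2 * L) powr \<alpha> + 1) * 1 \<le> b * exp (- (s * ?\<tau>))"
  proof -
    have "?\<tau> \<le> N powr \<alpha>" using t \<alpha> by (intro powr_mono2) auto
    then have "1 \<le> exp (s * N powr \<alpha>) * exp (- (s * ?\<tau>))" using s by (simp flip: exp_add)
    then have "((N + 2 * L) powr \<alpha> + 1) * 1 \<le> ((N + 2 * L) powr \<alpha> + 1) * (exp (s * N powr \<alpha>) * exp (- (s * ?\<tau>)))"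
      by (intro mult_left_mono) auto
    then show ?thesis by (simp add: b_def mult.assoc)
  qed
  have "2 * (b * exp (- (s * ?\<tau>))) \<le> b * ball_avg (\<lambda>y. exp (- (s * ?X y)))"
    using mult_left_mono[OF E b] by (simp only: mult.left_commute)
  moreover have avg: "ball_avg (\<lambda>y. profile s b (?X y)) = ball_avg ?X - b * ball_avg (\<lambda>y. exp (- (s * ?X y)))"
    unfolding profile_def using intX intE by (simp add: ball_avg_diff ball_avg_cmult)
  ultimately have "ball_avg ?X - b * ball_avg (\<lambda>y. exp (- (s * ?X y))) \<le> ?\<tau> - b * exp (- (s * ?\<tau>)) - 1"
    using X be powr_ge_zero[of t \<alpha>] by argo
  then have "ball_avg (\<lambda>y. profile s b (?X y)) \<le> profile s b ?\<tau> - 1"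
    unfolding avg by (simp only: profile_def)
  then show ?thesis by (simp add: M_def t_def)
qed

text \<open>
  One profile serves all distances from \<open>l / 2\<close> on (in units of \<open>\<epsilon>\<close>): the antipodal coupling is used
  up to a distance \<open>N\<close>, the reflection coupling beyond it.
\<close>

theorem coupling_contraction:
  fixes l L :: real
  assumes l: "0 < l" "l \<le> L" and gap: "(real CARD('n) - 1) * L\<^sup>2 < (real CARD('n) + 1) * l\<^sup>2"
  obtains \<alpha> s b c where "0 < \<alpha>" "\<alpha> < 1" "0 \<le> s" "0 \<le> b" "0 < c"
    "\<And>(S :: real^'n^'n) T d. pinched l L S \<Longrightarrow> pinched l L T \<Longrightarrow> l / 2 \<le> norm d \<Longrightarrow>
       \<exists>Q. orthogonal_matrix Q \<and>
         ball_avg (\<lambda>y. profile s b (norm (d + (S - T ** Q) *v y) powr \<alpha>))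
           \<le> profile s b (norm d powr \<alpha>) - c * norm d powr (\<alpha> - 2)"
proof -
  obtain \<sigma> where \<sigma>: "0 < \<sigma>" "\<And>v :: real^'n. ball_avg (\<lambda>y. (v \<bullet> y)\<^sup>2) = \<sigma> * (norm v)\<^sup>2"
    using ball_second_moment by blast
  define \<gamma> where "\<gamma> = (real CARD('n) + 1) * l\<^sup>2 - (real CARD('n) - 1) * L\<^sup>2"
  have \<gamma>: "0 < \<gamma>" using gap by (simp add: \<gamma>_def)
  define \<alpha> where "\<alpha> = min (1/2) (\<gamma> / (4 * L\<^sup>2))"
  have L: "0 < L" using l by simp
  have \<alpha>: "0 < \<alpha>" "\<alpha> < 1" using \<gamma> L by (simp_all add: \<alpha>_def)
  have "\<alpha> \<le> \<gamma> / (4 * L\<^sup>2)" by (simp add: \<alpha>_def)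
  then have \<alpha>L: "\<alpha> * (4 * L\<^sup>2) \<le> \<gamma>" using L by (simp add: pos_le_divide_eq)
  define N where "N = max (8 * L) (22 * (2 * L) ^ 3 / (\<sigma> * \<gamma>))"
  define p where "p = (l / (8 * L)) ^ CARD('n)"
  define k where "k = \<alpha> * (l / 4) * N powr (\<alpha> - 1)"
  \<comment> \<open>\<open>s\<close> makes the gain factor \<open>p exp (s k)\<close> equal to \<open>2\<close>, and \<open>b\<close> makes that gain
     exceed the largest possible value of the power part\<close>
  define s where "s = ln (2 / p) / k"
  define b where "b = ((N + 2 * L) powr \<alpha> + 1) * exp (s * N powr \<alpha>)"
  define c where "c = min (\<alpha> * \<sigma> * \<gamma> / 4) ((l / 2) powr (2 - \<alpha>))"
  have "0 < l / (8 * L)" "l / (8 * L) \<le> 1" using l by (simp_all add: field_simps)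
  then have "0 < p" "p \<le> 1" unfolding p_def by (auto intro: power_le_one)
  then have s: "0 \<le> s" unfolding s_def k_def using \<alpha> l by (intro divide_nonneg_nonneg ln_ge_zero) (auto simp: field_simps)
  have b: "0 \<le> b" by (simp add: b_def)
  have c: "0 < c" using \<alpha> \<sigma> \<gamma> l by (simp add: c_def)
  show thesis
  proof (rule that[OF \<alpha> s b c])
    fix S T :: "real^'n^'n" and d :: "real^'n"
    assume S: "pinched l L S" and T: "pinched l L T" and d: "l / 2 \<le> norm d"
    let ?g = "c * norm d powr (\<alpha> - 2)"
    show "\<exists>Q. orthogonal_matrix Q \<and>
         ball_avg (\<lambda>y. profile s b (norm (d + (S - T ** Q) *v y) powr \<alpha>))
           \<le> profile s b (norm d powr \<alpha>) - ?g"
    proof (cases "norm d \<le> N")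
      case True
      have "norm d powr (\<alpha> - 2) \<le> (l / 2) powr (\<alpha> - 2)"
        using d l \<alpha> by (intro powr_mono2') auto
      then have "?g \<le> (l / 2) powr (2 - \<alpha>) * (l / 2) powr (\<alpha> - 2)"
        using c by (intro mult_mono) (auto simp: c_def)
      also have "\<dots> = 1" using l by (simp flip: powr_add)
      finally have "?g \<le> 1" .
      moreover have "ball_avg (\<lambda>y. profile s b (norm (d + (S - T ** (- mat 1)) *v y) powr \<alpha>))
           \<le> profile s b (norm d powr \<alpha>) - 1"
        unfolding b_def s_def k_def p_def by (rule near_contraction[OF S T l \<alpha> d True])
      ultimately show ?thesis using orthogonal_matrix_minus_id by (intro exI[of _ "- mat 1"]) auto
    next
      case False
      then have "8 * L \<le> norm d" "22 * (2 * L) ^ 3 / (\<sigma> * \<gamma>) \<le> norm d" by (simp_all add: N_def)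
      then obtain Q where Q: "orthogonal_matrix Q" and avg:
        "ball_avg (\<lambda>y. norm (d + (S - T ** Q) *v y) powr \<alpha>)
          \<le> norm d powr \<alpha> - \<alpha> * \<sigma> * \<gamma> / 4 * norm d powr (\<alpha> - 2)"
        using far_contraction[OF S T l \<sigma> \<alpha> \<alpha>L \<gamma>, of d] by (auto simp: \<gamma>_def)
      let ?X = "\<lambda>y. norm (d + (S - T ** Q) *v y) powr \<alpha>"
      let ?\<tau> = "norm d powr \<alpha>"
      define K where "K = 1 + b * s * exp (- (s * ?\<tau>))"
      have K: "1 \<le> K" using b s by (simp add: K_def)
      have intX: "ball_integrable ?X" by (intro ball_integrable_continuous continuous_on_profile_dist \<alpha>)
      have int1: "ball_integrable (\<lambda>y. K * (?X y - ?\<tau>))"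
        by (intro ball_integrable_continuous continuous_intros continuous_on_profile_dist \<alpha>)
      have "c * norm d powr (\<alpha> - 2) \<le> \<alpha> * \<sigma> * \<gamma> / 4 * norm d powr (\<alpha> - 2)"
        by (intro mult_right_mono) (auto simp: c_def)
      then have drop: "ball_avg ?X - ?\<tau> \<le> - ?g" using avg by linarith
      have "ball_avg (\<lambda>y. profile s b (?X y)) \<le> ball_avg (\<lambda>y. profile s b ?\<tau> + K * (?X y - ?\<tau>))"
        by (intro ball_avg_mono ball_integrable_continuous continuous_intros continuous_on_profile_dist \<alpha>)
           (simp add: K_def profile_tangent[OF b])
      also have "\<dots> = profile s b ?\<tau> + K * (ball_avg ?X - ?\<tau>)"
        by (simp add: ball_avg_add ball_avg_cmult ball_avg_diff ball_integrable_const int1 intX)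
      also have "K * (ball_avg ?X - ?\<tau>) \<le> - ?g"
      proof -
        have "0 \<le> ?g" using c by simp
        then have "1 * ?g \<le> K * ?g" using K by (intro mult_right_mono) auto
        moreover have "K * (ball_avg ?X - ?\<tau>) \<le> K * (- ?g)" using drop K by (intro mult_left_mono) auto
        ultimately show ?thesis by linarith
      qed
      finally show ?thesis using Q by (intro exI[of _ Q]) simp
    qed
  qed
qed

section \<open>Ellipsoid averages and the comparison principle\<close>

lemma pinched_scaleR:
  assumes "pinched l L S" "0 < \<epsilon>"
  shows "pinched (\<epsilon> * l) (\<epsilon> * L) (\<epsilon> *\<^sub>R S)"
  using assms
  by (auto simp: pinched_def transpose_scalar scaleR_matrix_vector_assoc[symmetric] mult.assoc)

lemma det_scaleR_eq: "det (c *\<^sub>R (S :: real^'n^'n)) = det (c *\<^sub>R (mat 1 :: real^'n^'n)) * det S"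
proof -
  have "(c *\<^sub>R mat 1) ** S = c *\<^sub>R S"
    by (simp add: matrix_eq scaleR_matrix_vector_assoc[symmetric] flip: matrix_vector_mul_assoc)
  then show ?thesis by (metis det_mul)
qed

text \<open>
  The mean over an ellipsoid is a mean over the unit ball, and the rotation invariance of the ball
  leaves the freedom to insert any orthogonal \<open>Q\<close>: this freedom is the choice of coupling.
\<close>

lemma
  fixes S Q :: "real^'n^'n"
  assumes S: "pinched l L S" and l: "0 < l" and \<epsilon>: "0 < \<epsilon>" and Q: "orthogonal_matrix Q"
    and E: "E = (\<lambda>y. x + \<epsilon> *\<^sub>R (S *v y)) ` ball 0 1" and u: "set_integrable lebesgue E u"
  shows ball_integrable_ellipsoid: "ball_integrable (\<lambda>y. u (x + \<epsilon> *\<^sub>R ((S ** Q) *v y)))"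
    and ellipsoid_avg_eq_ball_avg:
      "1 / measure lebesgue E * (LINT y:E|lebesgue. u y) = ball_avg (\<lambda>y. u (x + \<epsilon> *\<^sub>R ((S ** Q) *v y)))"
proof -
  define W where "W = (\<epsilon> *\<^sub>R S) ** Q"
  have Wv: "W *v y = \<epsilon> *\<^sub>R ((S ** Q) *v y)" for y
    by (simp add: W_def scaleR_matrix_vector_assoc[symmetric] flip: matrix_vector_mul_assoc)
  have "det (\<epsilon> *\<^sub>R S) \<noteq> 0" using pinched_det_nonzero[OF pinched_scaleR[OF S \<epsilon>]] l \<epsilon> by simp
  then have det: "det W \<noteq> 0" using det_orthogonal_matrix[OF Q] by (auto simp: W_def det_mul)
  have "orthogonal_transformation ((*v) Q)" using Q by (simp add: orthogonal_transformation_matrix)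
  then have QB: "(*v) Q ` ball 0 1 = ball 0 1"
    using image_orthogonal_transformation_ball[of "(*v) Q" 0 1] by simp
  have "E = (\<lambda>y. x + \<epsilon> *\<^sub>R (S *v y)) ` ((*v) Q ` ball 0 1)" by (simp only: E QB)
  then have EW: "E = (\<lambda>y. x + W *v y) ` ball 0 1" unfolding Wv by (simp add: image_image matrix_vector_mul_assoc)
  show "ball_integrable (\<lambda>y. u (x + \<epsilon> *\<^sub>R ((S ** Q) *v y)))"
    using set_integrable_affine_matrix[OF det u[unfolded EW]] by (simp only: Wv)
  have "measure lebesgue E = \<bar>det W\<bar> * measure lebesgue (ball 0 1 :: (real^'n) set)"
    unfolding EW by (rule measure_affine_matrix_image[OF det]) simp
  then show "1 / measure lebesgue E * (LINT y:E|lebesgue. u y) = ball_avg (\<lambda>y. u (x + \<epsilon> *\<^sub>R ((S ** Q) *v y)))"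
    using set_integral_affine_matrix[OF det u[unfolded EW], folded EW] det
    by (simp add: ball_avg_def Wv)
qed

text \<open>
  The common part \<open>G\<close> cancels when the two domains have the same measure; what remains is a fraction
  \<open>1 - |G| / |X|\<close> of the largest difference of values.
\<close>

lemma average_diff_le_of_common_part:
  fixes u :: "real^'n \<Rightarrow> real"
  assumes X: "X \<in> lmeasurable" "set_integrable lebesgue X u" and Z: "Z \<in> lmeasurable" "set_integrable lebesgue Z u"
    and eq: "measure lebesgue X = measure lebesgue Z"
    and G: "G \<in> lmeasurable" "G \<subseteq> X" "G \<subseteq> Z" "measure lebesgue G < measure lebesgue X"
    and R: "\<And>x z. x \<in> X \<Longrightarrow> z \<in> Z \<Longrightarrow> u x - u z \<le> R"
  shows "1 / measure lebesgue X * (LINT y:X|lebesgue. u y) - 1 / measure lebesgue Z * (LINT y:Z|lebesgue. u y)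
    \<le> (1 - measure lebesgue G / measure lebesgue X) * R"
proof -
  let ?m = "measure lebesgue X - measure lebesgue G"
  have m: "0 < ?m" using G by simp
  have split: "(LINT y:Y|lebesgue. u y) = (LINT y:G|lebesgue. u y) + (LINT y:Y-G|lebesgue. u y)"
    and int: "set_integrable lebesgue (Y - G) u"
    and meas: "measure lebesgue (Y - G) = measure lebesgue Y - measure lebesgue G"
    and lm: "Y - G \<in> lmeasurable"
    if Y: "Y \<in> lmeasurable" "set_integrable lebesgue Y u" "G \<subseteq> Y" for Y
  proof -
    show int: "set_integrable lebesgue (Y - G) u"
      using Y(2) by (rule set_integrable_subset) (use Y G in auto)
    have "set_integrable lebesgue G u"
      using Y(2) by (rule set_integrable_subset) (use Y G in auto)
    from set_integral_Un[OF _ this int] show "(LINT y:Y|lebesgue. u y) = (LINT y:G|lebesgue. u y) + (LINT y:Y-G|lebesgue. u y)"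
      using Y(3) by (simp add: Un_absorb1)
    show "measure lebesgue (Y - G) = measure lebesgue Y - measure lebesgue G"
      using Y G by (intro measurable_measure_Diff) auto
    show "Y - G \<in> lmeasurable" using Y G by auto
  qed
  note sX = split[OF X G(2)] int[OF X G(2)] meas[OF X G(2)] lm[OF X G(2)]
  note sZ = split[OF Z G(3)] int[OF Z G(3)] meas[OF Z G(3)] lm[OF Z G(3)]
  have const: "set_integrable lebesgue Y (\<lambda>_. c)" "(LINT y:Y|lebesgue. c) = measure lebesgue Y * c"
    if "Y \<in> lmeasurable" for Y :: "(real^'n) set" and c :: real
    using that by (auto simp: absolutely_integrable_on_const set_lebesgue_integral_def fmeasurable_def)
  have "(LINT y:X-G|lebesgue. u y) \<le> ?m * (R + u z)" if z: "z \<in> Z" for z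
  proof -
    have "(LINT y:X-G|lebesgue. u y) \<le> (LINT y:X-G|lebesgue. R + u z)"
      using R[OF _ z] by (intro set_integral_mono sX const) (auto simp: algebra_simps)
    also have "\<dots> = ?m * (R + u z)" by (simp only: const(2)[OF sX(4)] sX(3))
    finally show ?thesis .
  qed
  then have le: "(LINT y:X-G|lebesgue. u y) / ?m - R \<le> u z" if "z \<in> Z" for z
  proof -
    have "(LINT y:X-G|lebesgue. u y) / ?m \<le> R + u z"
      using m \<open>\<And>z. z \<in> Z \<Longrightarrow> (LINT y:X-G|lebesgue. u y) \<le> ?m * (R + u z)\<close>[OF that]
      by (simp only: pos_divide_le_eq mult.commute)
    then show ?thesis by linarith
  qed
  have "(LINT y:Z-G|lebesgue. (LINT y:X-G|lebesgue. u y) / ?m - R) \<le> (LINT y:Z-G|lebesgue. u y)"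
    by (intro set_integral_mono sZ const le) auto
  then have "?m * ((LINT y:X-G|lebesgue. u y) / ?m - R) \<le> (LINT y:Z-G|lebesgue. u y)"
    by (simp only: const(2)[OF sZ(4)] sZ(3) eq)
  then have "(LINT y:X|lebesgue. u y) - (LINT y:Z|lebesgue. u y) \<le> ?m * R"
    using m unfolding sX(1) sZ(1) by (simp add: right_diff_distrib)
  then have "1 / measure lebesgue X * ((LINT y:X|lebesgue. u y) - (LINT y:Z|lebesgue. u y)) \<le> 1 / measure lebesgue X * (?m * R)"
    by (intro mult_left_mono) auto
  moreover have "1 / measure lebesgue X * (?m * R) = (1 - measure lebesgue G / measure lebesgue X) * R"
    using le_less_trans[OF measure_nonneg G(4)] by (simp add: field_simps)
  ultimately show ?thesis using eq by (simp add: right_diff_distrib)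
qed

lemma
  fixes S :: "real^'n^'n" and x :: "real^'n"
  assumes S: "pinched l L S" and l: "0 < l" "l \<le> L" and \<epsilon>: "0 < \<epsilon>"
  defines "E \<equiv> (\<lambda>y. x + \<epsilon> *\<^sub>R (S *v y)) ` ball 0 1"
  shows ellipsoid_subset_ball: "E \<subseteq> ball x (L * \<epsilon>)"
    and ball_subset_ellipsoid: "ball x (l * \<epsilon>) \<subseteq> E"
    and ellipsoid_lmeasurable: "E \<in> lmeasurable"
    and measure_ellipsoid:
      "measure lebesgue E = \<bar>det (\<epsilon> *\<^sub>R (mat 1 :: real^'n^'n)) * det S\<bar> * measure lebesgue (ball 0 1 :: (real^'n) set)"
proof -
  have det: "det (\<epsilon> *\<^sub>R S) \<noteq> 0" using pinched_det_nonzero[OF pinched_scaleR[OF S \<epsilon>]] l \<epsilon> by simp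
  have E': "E = (\<lambda>y. x + (\<epsilon> *\<^sub>R S) *v y) ` ball 0 1" by (simp add: E_def scaleR_matrix_vector_assoc)
  show "E \<in> lmeasurable" unfolding E' by (rule lmeasurable_affine_matrix_image[OF det]) simp
  show "measure lebesgue E = \<bar>det (\<epsilon> *\<^sub>R (mat 1 :: real^'n^'n)) * det S\<bar> * measure lebesgue (ball 0 1 :: (real^'n) set)"
    unfolding E' det_scaleR_eq[of \<epsilon> S, symmetric] by (rule measure_affine_matrix_image[OF det]) simp
  show "E \<subseteq> ball x (L * \<epsilon>)"
  proof
    fix w assume "w \<in> E"
    then obtain y where y: "norm y < 1" "w = x + \<epsilon> *\<^sub>R (S *v y)" by (auto simp: E_def)
    have "norm (S *v y) \<le> L * norm y" using S by (simp add: pinched_def)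
    also have "\<dots> < L * 1" using y l by (intro mult_strict_left_mono) auto
    finally have "\<epsilon> * norm (S *v y) < \<epsilon> * L" using \<epsilon> by simp
    then show "w \<in> ball x (L * \<epsilon>)" using \<epsilon> by (simp add: y dist_norm mult.commute)
  qed
  show "ball x (l * \<epsilon>) \<subseteq> E"
  proof
    fix w assume w: "w \<in> ball x (l * \<epsilon>)"
    have "det S \<noteq> 0" by (rule pinched_det_nonzero[OF S l(1)])
    then obtain V where V: "S ** V = mat 1" unfolding invertible_det_nz[symmetric] invertible_def by blast
    define y where "y = V *v ((1 / \<epsilon>) *\<^sub>R (w - x))"
    have Sy: "S *v y = (1 / \<epsilon>) *\<^sub>R (w - x)" by (simp add: y_def matrix_vector_mul_assoc V)
    have "l * norm y \<le> norm (w - x) / \<epsilon>" using pinched_norm_ge[OF S, of y] \<epsilon> by (simp add: Sy)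
    also have "\<dots> < l" using w \<epsilon> by (simp add: dist_norm norm_minus_commute pos_divide_less_eq)
    finally have "norm y < 1" using l by simp
    moreover have "w = x + \<epsilon> *\<^sub>R (S *v y)" using \<epsilon> by (simp add: Sy)
    ultimately show "w \<in> E" by (auto simp: E_def)
  qed
qed

text \<open>
  For centres closer than \<open>l \<epsilon> / 2\<close> the two ellipsoids share a ball of radius \<open>l \<epsilon> / 2\<close>, while
  each is contained in a ball of radius \<open>L \<epsilon>\<close>. The equality of the determinants makes the measures of
  the ellipsoids equal.
\<close>

lemma overlap_estimate:
  fixes S T :: "real^'n^'n" and u :: "real^'n \<Rightarrow> real"
  assumes S: "pinched l L S" and T: "pinched l L T" and l: "0 < l" "l \<le> L" and \<epsilon>: "0 < \<epsilon>"
    and det: "\<bar>det S\<bar> = \<bar>det T\<bar>"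
    and EX: "X = (\<lambda>y. x + \<epsilon> *\<^sub>R (S *v y)) ` ball 0 1" and EZ: "Z = (\<lambda>y. z + \<epsilon> *\<^sub>R (T *v y)) ` ball 0 1"
    and int: "set_integrable lebesgue X u" "set_integrable lebesgue Z u"
    and close: "dist x z \<le> l * \<epsilon> / 2"
    and R: "\<And>x' z'. dist x x' < L * \<epsilon> \<Longrightarrow> dist z z' < L * \<epsilon> \<Longrightarrow> u x' - u z' \<le> R" and R0: "0 \<le> R"
  shows "1 / measure lebesgue X * (LINT y:X|lebesgue. u y) - 1 / measure lebesgue Z * (LINT y:Z|lebesgue. u y)
    \<le> (1 - (l / (2 * L)) ^ CARD('n)) * R"
proof -
  let ?\<mu> = "measure lebesgue :: (real^'n) set \<Rightarrow> real" and ?G = "ball x (l * \<epsilon> / 2)"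
  let ?V = "?\<mu> (ball 0 1)"
  have ball: "?\<mu> (ball a \<rho>) = \<rho> ^ CARD('n) * ?V" if "0 \<le> \<rho>" for a \<rho>
    using content_ball_conv_unit_ball[of \<rho> a] that by simp
  note X = ellipsoid_subset_ball[OF S l \<epsilon>, of x, folded EX] ball_subset_ellipsoid[OF S l \<epsilon>, of x, folded EX]
     ellipsoid_lmeasurable[OF S l \<epsilon>, of x, folded EX] measure_ellipsoid[OF S l \<epsilon>, of x, folded EX]
  note Z = ellipsoid_subset_ball[OF T l \<epsilon>, of z, folded EZ] ball_subset_ellipsoid[OF T l \<epsilon>, of z, folded EZ]
     ellipsoid_lmeasurable[OF T l \<epsilon>, of z, folded EZ] measure_ellipsoid[OF T l \<epsilon>, of z, folded EZ]
  have pos: "0 < l * \<epsilon>" using l \<epsilon> by simp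
  have "?\<mu> ?G = (l * \<epsilon> / 2) ^ CARD('n) * ?V" using pos by (intro ball) simp
  also have "\<dots> < (l * \<epsilon>) ^ CARD('n) * ?V"
    using pos l \<epsilon> unit_ball_measure_pos[where 'n='n] by (intro mult_strict_right_mono power_strict_mono) auto
  also have "\<dots> = ?\<mu> (ball x (l * \<epsilon>))" using pos by (intro ball[symmetric]) simp
  also have "\<dots> \<le> ?\<mu> X" using X by (intro measure_mono_fmeasurable) auto
  finally have lt: "?\<mu> ?G < ?\<mu> X" .
  have "1 / ?\<mu> X * (LINT y:X|lebesgue. u y) - 1 / ?\<mu> Z * (LINT y:Z|lebesgue. u y) \<le> (1 - ?\<mu> ?G / ?\<mu> X) * R"
  proof (rule average_diff_le_of_common_part[OF X(3) int(1) Z(3) int(2) _ _ _ _ lt])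
    show "?\<mu> X = ?\<mu> Z" using det by (simp add: X(4) Z(4) abs_mult)
    show "?G \<subseteq> X" using X(2) pos by (auto simp: subset_eq)
    have "?G \<subseteq> ball z (l * \<epsilon>)" using close by (auto simp: ball_subset_ball_iff)
    then show "?G \<subseteq> Z" using Z(2) by blast
    show "u a - u b \<le> R" if "a \<in> X" "b \<in> Z" for a b using that X(1) Z(1) by (intro R) auto
  qed simp
  also have "\<dots> \<le> (1 - (l / (2 * L)) ^ CARD('n)) * R"
  proof -
    have "?\<mu> X \<le> ?\<mu> (ball x (L * \<epsilon>))" using X by (intro measure_mono_fmeasurable) auto
    also have "\<dots> = (L * \<epsilon>) ^ CARD('n) * ?V" using l \<epsilon> by (intro ball) simp
    finally have "(l / (2 * L)) ^ CARD('n) * ?\<mu> X \<le> (l / (2 * L)) ^ CARD('n) * ((L * \<epsilon>) ^ CARD('n) * ?V)"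
      using l by (intro mult_left_mono) auto
    also have "\<dots> = (l * \<epsilon> / 2) ^ CARD('n) * ?V"
      using l by (simp add: mult.assoc[symmetric] flip: power_mult_distrib)
    also have "\<dots> = ?\<mu> ?G" using pos by (intro ball[symmetric]) simp
    finally have "(l / (2 * L)) ^ CARD('n) \<le> ?\<mu> ?G / ?\<mu> X"
      using le_less_trans[OF measure_nonneg lt] by (simp only: pos_le_divide_eq)
    then show ?thesis using R0 by (intro mult_right_mono) auto
  qed
  finally show ?thesis .
qed

lemma step_norm_square_le:
  assumes "norm h \<le> L" "0 \<le> L" "0 \<le> \<epsilon>"
  shows "(dist (x + \<epsilon> *\<^sub>R h) m)\<^sup>2 \<le> (dist x m)\<^sup>2 + 2 * \<epsilon> * ((x - m) \<bullet> h) + (L * \<epsilon>)\<^sup>2"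
proof -
  have "(dist (x + \<epsilon> *\<^sub>R h) m)\<^sup>2 = (norm ((x - m) + \<epsilon> *\<^sub>R h))\<^sup>2"
    by (simp add: dist_norm algebra_simps)
  also have "\<dots> = (dist x m)\<^sup>2 + 2 * \<epsilon> * ((x - m) \<bullet> h) + (\<epsilon> * norm h)\<^sup>2"
    unfolding dist_norm power2_norm_eq_inner power_mult_distrib
    by (simp only: inner_add_left inner_add_right inner_scaleR_left inner_scaleR_right)
       (simp add: inner_commute power2_eq_square algebra_simps)
  also have "(\<epsilon> * norm h)\<^sup>2 \<le> (L * \<epsilon>)\<^sup>2"
    using assms by (intro power_mono) (auto simp: mult.commute[of L] intro: mult_left_mono)
  finally show ?thesis by simp
qed

text \<open>
  A maximum principle for pairs of points. Suppose that \<open>u x - u z - f x z\<close> has a positive supremum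
  \<open>\<theta>\<close> over pairs from the ball of radius \<open>r\<close> about \<open>m\<close>, where \<open>f\<close> is the right-hand side, replaced
  on the diagonal by its quadratic part. Take a pair at which the supremum is attained up to \<open>\<eta>\<close>. The
  pair is off the diagonal, where \<open>u x - u z = 0\<close>, and the quadratic term keeps both points in the ball
  of radius \<open>r / 2\<close>, so the averaging property applies and all averaged values stay below \<open>\<theta> + f\<close>.
  If the distance is at least \<open>l \<epsilon> / 2\<close>, the coupling lowers the average of \<open>f\<close> by more than \<open>\<eta>\<close>; if
  it is smaller, the overlap of the ellipsoids gives a factor \<open>1 - p\<close>, and the jump \<open>K\<close> of \<open>f\<close> at the
  diagonal is so large that \<open>p K\<close> outweighs the variation of \<open>f\<close> over the pairs reached in one step.
  Both are contradictions.
\<close>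

lemma comparison:
  fixes u :: "real^'n \<Rightarrow> real" and S :: "real^'n \<Rightarrow> real^'n^'n" and m :: "real^'n"
  assumes l: "0 < l" "l \<le> L" and \<alpha>: "0 < \<alpha>" "\<alpha> < 1" and sb: "0 \<le> s" "0 \<le> b" and c: "0 < c"
    and contraction: "\<And>(S :: real^'n^'n) T d. pinched l L S \<Longrightarrow> pinched l L T \<Longrightarrow> l / 2 \<le> norm d \<Longrightarrow>
       \<exists>Q. orthogonal_matrix Q \<and>
         ball_avg (\<lambda>y. profile s b (norm (d + (S - T ** Q) *v y) powr \<alpha>))
           \<le> profile s b (norm d powr \<alpha>) - c * norm d powr (\<alpha> - 2)"
    and r: "0 < r" and \<epsilon>: "0 < \<epsilon>" "L * \<epsilon> \<le> r / 2"
    and bound: "\<And>x. x \<in> ball m r \<Longrightarrow> \<bar>u x\<bar> \<le> B"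
    and S: "\<And>x. x \<in> ball m (r / 2) \<Longrightarrow> pinched l L (S x)"
    and avg: "\<And>x Q. x \<in> ball m (r / 2) \<Longrightarrow> orthogonal_matrix Q \<Longrightarrow>
       ball_integrable (\<lambda>y. u (x + \<epsilon> *\<^sub>R ((S x ** Q) *v y))) \<and>
       u x = ball_avg (\<lambda>y. u (x + \<epsilon> *\<^sub>R ((S x ** Q) *v y)))"
    and overlap: "\<And>x z R. x \<in> ball m (r / 2) \<Longrightarrow> z \<in> ball m (r / 2) \<Longrightarrow> dist x z \<le> l * \<epsilon> / 2 \<Longrightarrow>
       (\<And>x' z'. dist x x' < L * \<epsilon> \<Longrightarrow> dist z z' < L * \<epsilon> \<Longrightarrow> u x' - u z' \<le> R) \<Longrightarrow> 0 \<le> R \<Longrightarrow>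
       u x - u z \<le> (1 - p) * R"
    and p: "0 < p" "p \<le> 1"
    and K: "K = (b + (l / 2 + 2 * L) powr \<alpha> + 1) / p"
    and A: "0 \<le> A" "2 * B \<le> A * (r / 2)\<^sup>2"
    and C: "0 \<le> C" "4 * A * r * L * \<epsilon> + \<epsilon> powr \<alpha> \<le> C * \<epsilon> powr \<alpha>"
      "2 * A * L\<^sup>2 + 1 \<le> C * c * r powr (\<alpha> - 2)"
    and xz: "x \<in> ball m r" "z \<in> ball m r"
  shows "u x - u z \<le> C * \<epsilon> powr \<alpha> * (K + profile s b ((dist x z / \<epsilon>) powr \<alpha>)) + A * ((dist x m)\<^sup>2 + (dist z m)\<^sup>2)"
proof -
  have L: "0 < L" using l by simp
  define q where "q x z = (dist x m)\<^sup>2 + (dist z m)\<^sup>2" for x z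
  define \<Psi> where "\<Psi> x z = K + profile s b ((dist x z / \<epsilon>) powr \<alpha>)" for x z :: "real^'n"
  define D where "D = C * \<epsilon> powr \<alpha>"
  define f where "f x z = (if x = z then 0 else D * \<Psi> x z) + A * q x z" for x z :: "real^'n"
  have D: "0 \<le> D" using C by (simp add: D_def)
  have q: "0 \<le> q x z" for x z by (simp add: q_def)
  have "b + (l / 2 + 2 * L) powr \<alpha> + 1 = K * p" using p by (simp add: K)
  moreover have K0: "0 \<le> K" using sb p by (simp add: K)
  ultimately have K: "b + (l / 2 + 2 * L) powr \<alpha> + 1 = K * p" "0 \<le> K" "b \<le> K"
    using p mult_left_le[of p K] by auto (smt (verit) powr_ge_zero)
  have prof_ge: "- b \<le> profile s b \<tau>" if "0 \<le> \<tau>" for \<tau>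
  proof -
    have "b * exp (- (s * \<tau>)) \<le> b * 1" using sb that by (intro mult_left_mono) auto
    then show ?thesis using that by (simp add: profile_def)
  qed
  have prof_le: "profile s b \<tau> \<le> \<tau>" for \<tau> using sb by (simp add: profile_def)
  have \<Psi>: "0 \<le> \<Psi> x z" for x z using prof_ge[of "(dist x z / \<epsilon>) powr \<alpha>"] K by (simp add: \<Psi>_def)
  have f: "0 \<le> f x z" for x z using D \<Psi>[of x z] A q[of x z] by (simp add: f_def)
  have f_le: "f x z \<le> D * \<Psi> x z + A * q x z" for x z using mult_nonneg_nonneg[OF D \<Psi>[of x z]] by (auto simp: f_def)
  define g where "g w = u (fst w) - u (snd w) - f (fst w) (snd w)" for w
  let ?\<Gamma> = "ball m r \<times> ball m r"
  have g_le: "g w \<le> 2 * B" if "w \<in> ?\<Gamma>" for w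
    using bound[of "fst w"] bound[of "snd w"] that f[of "fst w" "snd w"] by (auto simp: g_def)
  have "g (x, z) \<le> 0"
  proof (rule ccontr)
    assume pos: "\<not> g (x, z) \<le> 0"
    have ne: "?\<Gamma> \<noteq> {}" using xz by blast
    have bdd: "bdd_above (g ` ?\<Gamma>)" using g_le by (rule bdd_aboveI2)
    define \<theta> where "\<theta> = (SUP w\<in>?\<Gamma>. g w)"
    have g\<theta>: "g w \<le> \<theta>" if "w \<in> ?\<Gamma>" for w unfolding \<theta>_def by (rule cSUP_upper[OF that bdd])
    have u\<theta>: "u x' - u z' \<le> \<theta> + (D * \<Psi> x' z' + A * q x' z')" if "x' \<in> ball m r" "z' \<in> ball m r" for x' z'
      using g\<theta>[of "(x', z')"] that f_le[of x' z'] by (simp add: g_def)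
    have \<theta>: "0 < \<theta>" using g\<theta>[of "(x, z)"] xz pos by auto
    \<comment> \<open>the slack that the conditions on \<open>C\<close> leave in the overlap case and in the coupled case\<close>
    define \<eta> where "\<eta> = min (\<epsilon> powr \<alpha>) (\<epsilon>\<^sup>2)"
    have \<eta>: "0 < \<eta>" using \<epsilon> by (simp add: \<eta>_def)
    have "max (\<theta> - \<eta>) 0 < \<theta>" using \<theta> \<eta> by simp
    then obtain w where w: "w \<in> ?\<Gamma>" "max (\<theta> - \<eta>) 0 < g w"
      unfolding \<theta>_def less_cSUP_iff[OF ne bdd] by blast
    obtain x z where [simp]: "w = (x, z)" by (cases w)
    have xz: "x \<in> ball m r" "z \<in> ball m r" and gpos: "0 < u x - u z - f x z" and gmax: "\<theta> - \<eta> < u x - u z - f x z"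
      using w by (auto simp: g_def)
    have "x \<noteq> z" using gpos f[of x z] by auto
    then have fxz: "f x z = D * \<Psi> x z + A * q x z" by (simp add: f_def)
    have inner: "x \<in> ball m (r / 2)" "z \<in> ball m (r / 2)"
    proof -
      have "A * q x z < A * (r / 2)\<^sup>2"
      proof -
        have "u x - u z \<le> 2 * B" using bound[OF xz(1)] bound[OF xz(2)] by linarith
        moreover have "A * q x z \<le> f x z" using D \<Psi>[of x z] by (simp add: f_def)
        ultimately show ?thesis using gpos A by linarith
      qed
      then have "q x z < (r / 2)\<^sup>2" using A(1) by (rule mult_left_less_imp_less)
      then have "(dist x m)\<^sup>2 < (r / 2)\<^sup>2" "(dist z m)\<^sup>2 < (r / 2)\<^sup>2"
        using zero_le_power2[of "dist x m"] zero_le_power2[of "dist z m"] unfolding q_def by linarith+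
      then have "dist x m < r / 2" "dist z m < r / 2" using r by (auto dest: power2_less_imp_less)
      then show "x \<in> ball m (r / 2)" "z \<in> ball m (r / 2)" by (auto simp: dist_commute)
    qed
    have near: "w' \<in> ball m r" if "v \<in> ball m (r / 2)" "dist v w' < L * \<epsilon>" for v w'
      using that \<epsilon>(2) dist_triangle[of m w' v] by simp
    define d where "d = (1 / \<epsilon>) *\<^sub>R (x - z)"
    have d: "norm d = dist x z / \<epsilon>" using \<epsilon> by (simp add: d_def dist_norm)
    show False
    proof (cases "l / 2 \<le> norm d")
      case True
      obtain Q where Q: "orthogonal_matrix Q" and contr:
        "ball_avg (\<lambda>y. profile s b (norm (d + (S x - S z ** Q) *v y) powr \<alpha>))
           \<le> profile s b (norm d powr \<alpha>) - c * norm d powr (\<alpha> - 2)"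
        using contraction[OF S[OF inner(1)] S[OF inner(2)] True] by blast
      \<comment> \<open>The linear terms in \<open>y\<close> coming from the quadratic part of \<open>f\<close> are collected in \<open>?v\<close>;
         they average to zero.\<close>
      let ?P = "S x ** mat 1" and ?R = "S z ** Q"
      let ?v = "transpose ?P *v (x - m) + transpose ?R *v (z - m)"
      let ?X = "\<lambda>y. norm (d + (S x - S z ** Q) *v y) powr \<alpha>"
      note ax = avg[OF inner(1) orthogonal_matrix_id] and az = avg[OF inner(2) Q]
      define a0 where "a0 = \<theta> + D * K + A * (q x z + 2 * (L * \<epsilon>)\<^sup>2)"
      have intP: "ball_integrable (\<lambda>y. D * profile s b (?X y))"
        "ball_integrable (\<lambda>y. 2 * \<epsilon> * A * (?v \<bullet> y))" 
        by (intro ball_integrable_continuous continuous_intros continuous_on_profile_dist \<alpha>)+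
      have "u x - u z = ball_avg (\<lambda>y. u (x + \<epsilon> *\<^sub>R (?P *v y)) - u (z + \<epsilon> *\<^sub>R (?R *v y)))"
        using ax az by (simp add: ball_avg_diff)
      also have "\<dots> \<le> ball_avg (\<lambda>y. a0 + (D * profile s b (?X y) + 2 * \<epsilon> * A * (?v \<bullet> y)))"
      proof (rule ball_avg_mono)
        show "ball_integrable (\<lambda>y. u (x + \<epsilon> *\<^sub>R (?P *v y)) - u (z + \<epsilon> *\<^sub>R (?R *v y)))"
          using ax az by (intro set_integral_diff) auto
        show "ball_integrable (\<lambda>y. a0 + (D * profile s b (?X y) + 2 * \<epsilon> * A * (?v \<bullet> y)))"
          by (intro set_integral_add ball_integrable_const intP)
        fix y :: "real^'n" assume y: "norm y < 1"
        let ?x = "x + \<epsilon> *\<^sub>R (?P *v y)" and ?z = "z + \<epsilon> *\<^sub>R (?R *v y)"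
        have step: "norm (T *v (U *v y)) < L" if "pinched l L T" "orthogonal_matrix U" for T U :: "real^'n^'n"
        proof -
          have "norm (T *v (U *v y)) \<le> L * norm (U *v y)" using that by (simp add: pinched_def)
          also have "\<dots> = L * norm y" by (simp add: norm_orthogonal_matrix_vec[OF that(2)])
          also have "\<dots> < L * 1" using y L by (intro mult_strict_left_mono) auto
          finally show ?thesis by simp
        qed
        have hx: "norm (?P *v y) < L" using step[OF S[OF inner(1)] orthogonal_matrix_id]
          by (simp add: matrix_vector_mul_assoc)
        have hz: "norm (?R *v y) < L" using step[OF S[OF inner(2)] Q]
          by (simp add: matrix_vector_mul_assoc)
        have "dist x ?x < L * \<epsilon>" "dist z ?z < L * \<epsilon>"
          using hx hz \<epsilon> by (simp_all add: dist_norm mult.commute)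
        then have "?x \<in> ball m r" "?z \<in> ball m r"
          using near[OF inner(1)] near[OF inner(2)] by blast+
        from u\<theta>[OF this] have "u ?x - u ?z \<le> \<theta> + (D * \<Psi> ?x ?z + A * q ?x ?z)" .
        moreover have "\<Psi> ?x ?z = K + profile s b (?X y)"
        proof -
          have "?x - ?z = \<epsilon> *\<^sub>R (d + (S x - S z ** Q) *v y)"
            using \<epsilon> by (simp add: d_def matrix_vector_mult_diff_rdistrib algebra_simps)
          then show ?thesis using \<epsilon> by (simp add: \<Psi>_def dist_norm)
        qed
        moreover have "q ?x ?z \<le> q x z + 2 * (L * \<epsilon>)\<^sup>2 + 2 * \<epsilon> * (?v \<bullet> y)"
        proof -
          have "?v \<bullet> y = (x - m) \<bullet> (?P *v y) + (z - m) \<bullet> (?R *v y)"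
            by (simp only: inner_add_left transpose_matrix_vector dot_lmul_matrix)
          then have "2 * \<epsilon> * (?v \<bullet> y) = 2 * \<epsilon> * ((x - m) \<bullet> (?P *v y)) + 2 * \<epsilon> * ((z - m) \<bullet> (?R *v y))"
            by (simp only: distrib_left)
          then show ?thesis
            using step_norm_square_le[of "?P *v y" L \<epsilon> x m] step_norm_square_le[of "?R *v y" L \<epsilon> z m] hx hz L \<epsilon>
            unfolding q_def by linarith
        qed
        then have "A * q ?x ?z \<le> A * (q x z + 2 * (L * \<epsilon>)\<^sup>2 + 2 * \<epsilon> * (?v \<bullet> y))"
          using A(1) by (rule mult_left_mono)
        moreover have "A * (q x z + 2 * (L * \<epsilon>)\<^sup>2 + 2 * \<epsilon> * (?v \<bullet> y))
            = A * (q x z + 2 * (L * \<epsilon>)\<^sup>2) + 2 * \<epsilon> * A * (?v \<bullet> y)" by (simp only: distrib_left mult_ac)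
        ultimately show "u ?x - u ?z \<le> a0 + (D * profile s b (?X y) + 2 * \<epsilon> * A * (?v \<bullet> y))"
          unfolding a0_def by (simp only: distrib_left)
      qed
      also have "\<dots> = a0 + (D * ball_avg (\<lambda>y. profile s b (?X y)) + 2 * \<epsilon> * A * ball_avg (\<lambda>y. ?v \<bullet> y))"
        using intP by (simp only: ball_avg_add ball_avg_const ball_avg_cmult ball_integrable_const set_integral_add)
      also have "\<dots> = a0 + D * ball_avg (\<lambda>y. profile s b (?X y))" by (simp only: ball_avg_linear)
      also have "\<dots> \<le> a0 + D * (profile s b (norm d powr \<alpha>) - c * norm d powr (\<alpha> - 2))"
        using contr D by (intro add_left_mono mult_left_mono) auto
      finally have "u x - u z \<le> \<theta> + A * (2 * (L * \<epsilon>)\<^sup>2) + f x z - D * (c * norm d powr (\<alpha> - 2))"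
        unfolding fxz a0_def \<Psi>_def d by (simp add: algebra_simps)
      then have 1: "D * (c * norm d powr (\<alpha> - 2)) < \<eta> + A * (2 * (L * \<epsilon>)\<^sup>2)" using gmax by linarith
      have "dist x z < r" using inner dist_triangle_half_r[of m x r z] by auto
      then have "r powr (\<alpha> - 2) \<le> dist x z powr (\<alpha> - 2)" using \<open>x \<noteq> z\<close> \<alpha> by (intro powr_mono2') auto
      then have "C * c * (r powr (\<alpha> - 2)) * \<epsilon>\<^sup>2 \<le> C * c * (dist x z powr (\<alpha> - 2)) * \<epsilon>\<^sup>2"
        using C c by (intro mult_left_mono mult_right_mono) auto
      also have "\<dots> = D * (c * norm d powr (\<alpha> - 2))"
      proof -
        have "norm d powr (\<alpha> - 2) * \<epsilon> powr \<alpha> = dist x z powr (\<alpha> - 2) * \<epsilon>\<^sup>2"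
          using \<epsilon> by (simp add: d powr_divide powr_diff)
        then show ?thesis by (simp add: D_def mult_ac)
      qed
      finally have "(2 * A * L\<^sup>2 + 1) * \<epsilon>\<^sup>2 \<le> D * (c * norm d powr (\<alpha> - 2))"
        using mult_right_mono[OF C(3) zero_le_power2[of \<epsilon>]] by linarith
      moreover have "(2 * A * L\<^sup>2 + 1) * \<epsilon>\<^sup>2 = A * (2 * (L * \<epsilon>)\<^sup>2) + \<epsilon>\<^sup>2" by (simp add: power_mult_distrib algebra_simps)
      moreover have "\<eta> \<le> \<epsilon>\<^sup>2" by (simp add: \<eta>_def)
      ultimately show False using 1 by linarith
    next
      case False
      then have close: "dist x z \<le> l * \<epsilon> / 2" using \<epsilon> by (simp add: d field_simps)
      define c1 where "c1 = (l / 2 + 2 * L) powr \<alpha>"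
      define R where "R = \<theta> + D * (K + c1) + A * (q x z + 4 * r * L * \<epsilon>)"
      have "0 \<le> c1" by (simp add: c1_def)
      have nn: "0 \<le> D * (K + c1)" "0 \<le> A * (q x z + 4 * r * L * \<epsilon>)"
        using D K \<open>0 \<le> c1\<close> A q[of x z] r L \<epsilon> by auto
      have "u x' - u z' \<le> R" if x': "dist x x' < L * \<epsilon>" and z': "dist z z' < L * \<epsilon>" for x' z'
      proof -
        have in': "x' \<in> ball m r" "z' \<in> ball m r" using near inner x' z' by blast+
        have "dist x' z' \<le> (l / 2 + 2 * L) * \<epsilon>"
          using dist_triangle[of x' z' x] dist_triangle[of x z' z] x' z' close
          by (simp add: dist_commute algebra_simps)
        then have "dist x' z' / \<epsilon> \<le> l / 2 + 2 * L" using \<epsilon> by (simp add: pos_divide_le_eq)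
        then have "(dist x' z' / \<epsilon>) powr \<alpha> \<le> c1" unfolding c1_def using \<epsilon> \<alpha> by (intro powr_mono2) auto
        then have "\<Psi> x' z' \<le> K + c1" using prof_le[of "(dist x' z' / \<epsilon>) powr \<alpha>"] by (simp add: \<Psi>_def)
        then have "D * \<Psi> x' z' \<le> D * (K + c1)" using D by (intro mult_left_mono) auto
        moreover have sq: "(dist v' m)\<^sup>2 \<le> (dist v m)\<^sup>2 + 2 * r * L * \<epsilon>"
          if v: "v \<in> ball m (r / 2)" and v': "dist v v' < L * \<epsilon>" for v v'
        proof -
          have "dist v' m \<le> dist v m + L * \<epsilon>" using dist_triangle[of v' m v] v' by (simp add: dist_commute)
          then have "(dist v' m)\<^sup>2 \<le> (dist v m + L * \<epsilon>)\<^sup>2" by (intro power_mono) auto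
          also have "\<dots> = (dist v m)\<^sup>2 + (2 * dist v m + L * \<epsilon>) * (L * \<epsilon>)" by (simp add: power2_eq_square algebra_simps)
          also have "(2 * dist v m + L * \<epsilon>) * (L * \<epsilon>) \<le> (2 * r) * (L * \<epsilon>)"
            using v \<epsilon> L r by (intro mult_right_mono) (auto simp: dist_commute)
          finally show ?thesis by (simp add: mult_ac)
        qed
        have "q x' z' \<le> q x z + 4 * r * L * \<epsilon>" using sq[OF inner(1) x'] sq[OF inner(2) z'] by (simp add: q_def)
        then have "A * q x' z' \<le> A * (q x z + 4 * r * L * \<epsilon>)" using A by (intro mult_left_mono) auto
        ultimately show ?thesis using u\<theta>[OF in'] unfolding R_def by linarith
      qed
      moreover have "0 \<le> R" using nn \<theta> by (simp add: R_def)
      ultimately have "u x - u z \<le> (1 - p) * R" by (rule overlap[OF inner close])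
      also have "\<dots> \<le> R - p * (D * K)"
      proof -
        have "D * K \<le> R" using nn(2) \<theta> D \<open>0 \<le> c1\<close> mult_nonneg_nonneg[OF D \<open>0 \<le> c1\<close>] by (simp add: R_def distrib_left)
        then have "p * (D * K) \<le> p * R" using p by (intro mult_left_mono) auto
        then show ?thesis by (simp add: left_diff_distrib)
      qed
      finally have "u x - u z \<le> \<theta> + D * (K + c1) + A * (q x z + 4 * r * L * \<epsilon>) - p * (D * K)" by (simp add: R_def)
      moreover have "D * (K - b) + A * q x z \<le> f x z"
        unfolding fxz \<Psi>_def using D prof_ge[of "(dist x z / \<epsilon>) powr \<alpha>"] by (intro add_right_mono mult_left_mono) auto
      ultimately have "D * (K - b) < \<eta> + D * (K + c1) + A * (4 * r * L * \<epsilon>) - p * (D * K)"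
        using gmax by (simp add: distrib_left)
      then have "D * (K * p - b - c1) < \<eta> + 4 * A * r * L * \<epsilon>" by (simp add: algebra_simps)
      moreover have "K * p - b - c1 = 1" using K by (simp add: c1_def)
      ultimately have "D < \<eta> + 4 * A * r * L * \<epsilon>" by simp
      then show False using C(2) by (simp add: D_def \<eta>_def)
    qed
  qed
  then have "u x - u z \<le> f x z" by (simp add: g_def)
  also have "\<dots> \<le> D * \<Psi> x z + A * q x z" by (rule f_le)
  finally show ?thesis by (simp add: D_def \<Psi>_def q_def)
qed

section \<open>Asymptotic Hoelder regularity\<close>

lemma powr_le_smaller_exponent:
  fixes t r \<alpha> \<beta> :: real
  assumes "0 \<le> t" "t \<le> r" "0 < \<alpha>" "\<alpha> \<le> \<beta>"
  shows "t powr \<beta> \<le> r powr (\<beta> - \<alpha>) * t powr \<alpha>"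
proof -
  have "t powr \<beta> = t powr (\<beta> - \<alpha>) * t powr \<alpha>" by (simp flip: powr_add)
  also have "\<dots> \<le> r powr (\<beta> - \<alpha>) * t powr \<alpha>"
    using assms by (intro mult_right_mono powr_mono2) auto
  finally show ?thesis .
qed

lemma one_le_powr_quotient:
  fixes t r \<alpha> :: real
  assumes "0 < r" "r \<le> t" "0 < \<alpha>"
  shows "1 \<le> r powr (- \<alpha>) * t powr \<alpha>"
proof -
  have "1 = r powr (- \<alpha>) * r powr \<alpha>" using assms by (simp flip: powr_add)
  also have "\<dots> \<le> r powr (- \<alpha>) * t powr \<alpha>"
    using assms by (intro mult_left_mono powr_mono2) auto
  finally show ?thesis .
qed

theorem theorem1p1:
  fixes lam Lam :: real
  assumes "2 \<le> CARD('n::finite)"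
    and "0 < lam" "lam \<le> Lam"
    and "1 \<le> Lam / lam"
    and "Lam / lam < (real CARD('n) + 1) / (real CARD('n) - 1)"
  shows "\<exists>\<alpha>::real. 0 < \<alpha> \<and> \<alpha> < 1 \<and>
    (\<forall>r>0. \<forall>M. \<exists>C>0.
      \<forall>(\<Omega> :: (real^'n) set) (D :: (real^'n) set) (A :: real^'n \<Rightarrow> real^'n^'n)
        (x0 :: real^'n) (\<epsilon> :: real) (u :: real^'n \<Rightarrow> real).
        open \<Omega> \<and> connected \<Omega> \<and>
        A \<in> \<Omega> \<rightarrow> elliptic_matrices lam Lam \<and>
        A \<in> borel_measurable (lebesgue_on \<Omega>) \<and>
        (\<exists>d. \<forall>x\<in>\<Omega>. det (A x) = d) \<and>
        ball x0 (2 * r) \<subseteq> \<Omega> \<and>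
        0 < \<epsilon> \<and>
        dpp_solution D \<Omega> \<epsilon> A u \<and>
        bounded (u ` ball x0 (2 * r)) \<and>
        (SUP y\<in>ball x0 (2 * r). \<bar>u y\<bar>) = M \<longrightarrow>
        (\<forall>x\<in>ball x0 r. \<forall>z\<in>ball x0 r.
          \<bar>u x - u z\<bar> \<le> C * (dist x z powr \<alpha> + \<epsilon> powr \<alpha>)))"
proof -
  let ?n = "real CARD('n)"
  define l where "l = sqrt lam"
  define L where "L = sqrt Lam"
  have l: "0 < l" "l \<le> L" and l2: "l\<^sup>2 = lam" "L\<^sup>2 = Lam" using assms by (simp_all add: l_def L_def)
  have L: "0 < L" using l by simp
  have n: "1 < ?n" using assms(1) by simp
  then have "Lam * (?n - 1) < lam * (?n + 1)"
    using assms(2,5) by (simp add: divide_less_eq less_divide_eq mult.commute)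
  then have gap: "(?n - 1) * L\<^sup>2 < (?n + 1) * l\<^sup>2" by (simp add: l2 mult.commute)
  obtain \<alpha> s b c where \<alpha>: "0 < \<alpha>" "\<alpha> < 1" and sb: "0 \<le> s" "0 \<le> b" and c: "0 < c"
    and contraction: "\<And>(S :: real^'n^'n) T d. pinched l L S \<Longrightarrow> pinched l L T \<Longrightarrow> l / 2 \<le> norm d \<Longrightarrow>
       \<exists>Q. orthogonal_matrix Q \<and>
         ball_avg (\<lambda>y. profile s b (norm (d + (S - T ** Q) *v y) powr \<alpha>))
           \<le> profile s b (norm d powr \<alpha>) - c * norm d powr (\<alpha> - 2)"
    using coupling_contraction[OF l gap] by blast
  define p where "p = (l / (2 * L)) ^ CARD('n)"
  have "0 < l / (2 * L)" "l / (2 * L) \<le> 1" using l by (simp_all add: field_simps)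
  then have p: "0 < p" "p \<le> 1" unfolding p_def by (auto intro: power_le_one)
  define K where "K = (b + (l / 2 + 2 * L) powr \<alpha> + 1) / p"
  have K: "0 \<le> K" using sb p by (simp add: K_def)
  show ?thesis
  proof (rule exI[of _ \<alpha>], intro conjI allI impI \<alpha>)
    fix r M :: real assume r: "0 < r"
    \<comment> \<open>\<open>\<rho>\<close> is the largest step size for which the ellipsoids centred in the half ball stay in the ball;
       with \<open>a\<close> the quadratic term dominates the oscillation of \<open>u\<close> outside the half ball; \<open>C1\<close> and \<open>C2\<close>
       serve the overlap case and the coupled case of the comparison.\<close>
    define B where "B = \<bar>M\<bar>"
    define \<rho> where "\<rho> = r / (2 * L)"
    define a where "a = 8 * B / r\<^sup>2"
    have B: "0 \<le> B" by (simp add: B_def)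
    have \<rho>: "0 < \<rho>" using r L by (simp add: \<rho>_def)
    have a: "0 \<le> a" "2 * B \<le> a * (r / 2)\<^sup>2" using B r by (simp_all add: a_def power2_eq_square)
    define C1 where "C1 = 4 * a * r * L * \<rho> powr (1 - \<alpha>) + 1"
    define C2 where "C2 = (2 * a * L\<^sup>2 + 1) / (c * r powr (\<alpha> - 2))"
    define C0 where "C0 = C1 + C2"
    have C1: "0 \<le> C1" using a r L by (simp add: C1_def)
    have C2: "0 \<le> C2" using a c by (simp add: C2_def)
    have C0: "0 \<le> C0" using C1 C2 by (simp add: C0_def)
    define C where "C = C0 * (K + 1) + a * r powr (2 - \<alpha>) + 2 * B * \<rho> powr (- \<alpha>) + 2 * B * r powr (- \<alpha>) + 1"
    have Cparts: "0 \<le> C0 * K" "0 \<le> a * r powr (2 - \<alpha>)" "0 \<le> 2 * B * \<rho> powr (- \<alpha>)" "0 \<le> 2 * B * r powr (- \<alpha>)"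
      using C0 K a B by auto
    have Cge: "C0 * K \<le> C" "C0 + a * r powr (2 - \<alpha>) \<le> C" "2 * B * \<rho> powr (- \<alpha>) \<le> C" "2 * B * r powr (- \<alpha>) \<le> C" "0 < C"
      using Cparts C0 unfolding C_def by (simp_all add: distrib_left)
    show "\<exists>C>0. \<forall>(\<Omega> :: (real^'n) set) (D :: (real^'n) set) (A :: real^'n \<Rightarrow> real^'n^'n)
        (x0 :: real^'n) (\<epsilon> :: real) (u :: real^'n \<Rightarrow> real).
        open \<Omega> \<and> connected \<Omega> \<and>
        A \<in> \<Omega> \<rightarrow> elliptic_matrices lam Lam \<and>
        A \<in> borel_measurable (lebesgue_on \<Omega>) \<and>
        (\<exists>d. \<forall>x\<in>\<Omega>. det (A x) = d) \<and>
        ball x0 (2 * r) \<subseteq> \<Omega> \<and>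
        0 < \<epsilon> \<and>
        dpp_solution D \<Omega> \<epsilon> A u \<and>
        bounded (u ` ball x0 (2 * r)) \<and>
        (SUP y\<in>ball x0 (2 * r). \<bar>u y\<bar>) = M \<longrightarrow>
        (\<forall>x\<in>ball x0 r. \<forall>z\<in>ball x0 r.
          \<bar>u x - u z\<bar> \<le> C * (dist x z powr \<alpha> + \<epsilon> powr \<alpha>))"
    proof (intro exI[of _ C] conjI allI impI ballI \<open>0 < C\<close>)
      fix \<Omega> D :: "(real^'n) set" and A :: "real^'n \<Rightarrow> real^'n^'n" and x0 :: "real^'n" and \<epsilon> :: real
        and u :: "real^'n \<Rightarrow> real" and x z
      assume "open \<Omega> \<and> connected \<Omega> \<and>
        A \<in> \<Omega> \<rightarrow> elliptic_matrices lam Lam \<and>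
        A \<in> borel_measurable (lebesgue_on \<Omega>) \<and>
        (\<exists>d. \<forall>x\<in>\<Omega>. det (A x) = d) \<and>
        ball x0 (2 * r) \<subseteq> \<Omega> \<and>
        0 < \<epsilon> \<and>
        dpp_solution D \<Omega> \<epsilon> A u \<and>
        bounded (u ` ball x0 (2 * r)) \<and>
        (SUP y\<in>ball x0 (2 * r). \<bar>u y\<bar>) = M"
      then obtain \<delta> where A: "A \<in> \<Omega> \<rightarrow> elliptic_matrices lam Lam" and det: "\<forall>x\<in>\<Omega>. det (A x) = \<delta>"
        and sub: "ball x0 (2 * r) \<subseteq> \<Omega>" and \<epsilon>: "0 < \<epsilon>" and dpp: "dpp_solution D \<Omega> \<epsilon> A u"
        and bdd: "bounded (u ` ball x0 (2 * r))" and SUP: "(SUP y\<in>ball x0 (2 * r). \<bar>u y\<bar>) = M"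
        by blast
      assume x: "x \<in> ball x0 r" and z: "z \<in> ball x0 r"
      let ?S = "\<lambda>x. matrix_sqrt (A x)"
      have S: "pinched l L (?S x)" and SS: "?S x ** ?S x = A x" if "x \<in> \<Omega>" for x
        using matrix_sqrt_elliptic[of "A x" lam Lam] A that assms(2) by (auto simp: l_def L_def)
      have detS: "\<bar>det (?S x)\<bar> = \<bar>det (?S z)\<bar>" if "x \<in> \<Omega>" "z \<in> \<Omega>" for x z
      proof -
        have "det (?S x) * det (?S x) = det (?S z) * det (?S z)"
          using SS[OF that(1)] SS[OF that(2)] det that by (metis det_mul)
        then show ?thesis by (metis power2_eq_square power2_eq_iff abs_minus_cancel)
      qed
      have bound: "\<bar>u y\<bar> \<le> B" if "y \<in> ball x0 (2 * r)" for y
      proof -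
        obtain b where "\<And>y. y \<in> ball x0 (2 * r) \<Longrightarrow> \<bar>u y\<bar> \<le> b"
          using bdd unfolding bounded_iff by (metis imageI real_norm_def)
        then have "bdd_above ((\<lambda>y. \<bar>u y\<bar>) ` ball x0 (2 * r))" by (rule bdd_aboveI2)
        from cSUP_upper[OF that this] show ?thesis by (simp add: SUP B_def)
      qed
      have \<Omega>: "x \<in> \<Omega>" "z \<in> \<Omega>" and ball2: "x \<in> ball x0 (2 * r)" "z \<in> ball x0 (2 * r)"
        using x z r sub by (auto intro!: subsetD[OF sub])
      define t where "t = dist x z"
      have t: "0 \<le> t" by (simp add: t_def)
      have trivial: "\<bar>u x - u z\<bar> \<le> 2 * B" using bound[OF ball2(1)] bound[OF ball2(2)] by linarith
      show "\<bar>u x - u z\<bar> \<le> C * (dist x z powr \<alpha> + \<epsilon> powr \<alpha>)"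
      proof -
        consider "\<rho> \<le> \<epsilon>" | "r \<le> t" | "\<epsilon> < \<rho>" "t < r" by linarith
        then show ?thesis
        proof cases
          case 1
          have "2 * B * 1 \<le> 2 * B * (\<rho> powr (- \<alpha>) * \<epsilon> powr \<alpha>)"
            using B one_le_powr_quotient[OF \<rho> 1 \<alpha>(1)] by (intro mult_left_mono) auto
          also have "\<dots> = (2 * B * \<rho> powr (- \<alpha>)) * \<epsilon> powr \<alpha>" by simp
          also have "\<dots> \<le> C * \<epsilon> powr \<alpha>" using Cge by (intro mult_right_mono) auto
          also have "\<dots> \<le> C * (dist x z powr \<alpha> + \<epsilon> powr \<alpha>)" using Cge by (intro mult_left_mono) auto
          finally show ?thesis using trivial by simp
        next
          case 2
          have "2 * B * 1 \<le> 2 * B * (r powr (- \<alpha>) * t powr \<alpha>)"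
            using B one_le_powr_quotient[OF r 2 \<alpha>(1)] by (intro mult_left_mono) auto
          also have "\<dots> = (2 * B * r powr (- \<alpha>)) * t powr \<alpha>" by simp
          also have "\<dots> \<le> C * t powr \<alpha>" using Cge by (intro mult_right_mono) auto
          also have "\<dots> \<le> C * (dist x z powr \<alpha> + \<epsilon> powr \<alpha>)" using Cge by (intro mult_left_mono) (auto simp: t_def)
          finally show ?thesis using trivial by simp
        next
          case 3
          \<comment> \<open>centring at the midpoint makes the quadratic term of order \<open>t\<^sup>2\<close> at the given pair\<close>
          define m where "m = midpoint x z"
          have dm: "dist x m = t / 2" "dist z m = t / 2"
            by (simp_all add: m_def t_def dist_midpoint dist_commute)
          have xm: "x \<in> ball m r" "z \<in> ball m r" using dm 3 t by (auto simp: dist_commute)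
          have "m \<in> ball x0 r"
            unfolding m_def by (rule subsetD[OF closed_segment_subset[OF x z convex_ball]]) simp
          then have msub: "ball m r \<subseteq> ball x0 (2 * r)" by (auto simp: ball_subset_ball_iff dist_commute)
          have half: "v \<in> \<Omega>" if "v \<in> ball m (r / 2)" for v
            using that msub sub r by (auto intro!: subsetD[OF sub] subsetD[OF msub])
          have L\<epsilon>: "L * \<epsilon> \<le> r / 2" using 3 L by (simp add: \<rho>_def field_simps)
          have E: "ellipsoid \<epsilon> A v = (\<lambda>y. v + \<epsilon> *\<^sub>R (?S v *v y)) ` ball 0 1" for v by (simp add: ellipsoid_def)
          have uE: "u v = 1 / measure lebesgue (ellipsoid \<epsilon> A v) * (LINT y:ellipsoid \<epsilon> A v|lebesgue. u y)"
            and intE: "set_integrable lebesgue (ellipsoid \<epsilon> A v) u" if "v \<in> \<Omega>" for v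
            using dpp that by (auto simp: dpp_solution_def)
          have C01: "4 * a * r * L * \<epsilon> + \<epsilon> powr \<alpha> \<le> C0 * \<epsilon> powr \<alpha>"
          proof -
            have "\<epsilon> \<le> \<rho> powr (1 - \<alpha>) * \<epsilon> powr \<alpha>"
              using powr_le_smaller_exponent[of \<epsilon> \<rho> \<alpha> 1] \<epsilon> 3 \<alpha> by simp
            then have "4 * a * r * L * \<epsilon> \<le> 4 * a * r * L * (\<rho> powr (1 - \<alpha>) * \<epsilon> powr \<alpha>)"
              using a r L by (intro mult_left_mono) auto
            then have "4 * a * r * L * \<epsilon> + \<epsilon> powr \<alpha> \<le> C1 * \<epsilon> powr \<alpha>" by (simp add: C1_def algebra_simps)
            also have "\<dots> \<le> C0 * \<epsilon> powr \<alpha>" using C2 by (intro mult_right_mono) (auto simp: C0_def)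
            finally show ?thesis .
          qed
          have C02: "2 * a * L\<^sup>2 + 1 \<le> C0 * c * r powr (\<alpha> - 2)"
          proof -
            have "0 < c * r powr (\<alpha> - 2)" using c r by simp
            then have "2 * a * L\<^sup>2 + 1 = C2 * (c * r powr (\<alpha> - 2))" using c r by (simp add: C2_def)
            also have "\<dots> \<le> C0 * (c * r powr (\<alpha> - 2))" using C1 c by (intro mult_right_mono) (auto simp: C0_def)
            finally show ?thesis by (simp add: mult.assoc)
          qed
          have avg: "ball_integrable (\<lambda>y. u (v + \<epsilon> *\<^sub>R ((?S v ** Q) *v y))) \<and>
              u v = ball_avg (\<lambda>y. u (v + \<epsilon> *\<^sub>R ((?S v ** Q) *v y)))"
            if v: "v \<in> ball m (r / 2)" and Q: "orthogonal_matrix Q" for v Q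
            using ball_integrable_ellipsoid[OF S[OF half[OF v]] l(1) \<epsilon> Q E intE[OF half[OF v]]]
              ellipsoid_avg_eq_ball_avg[OF S[OF half[OF v]] l(1) \<epsilon> Q E intE[OF half[OF v]]]
              uE[OF half[OF v]] by simp
          have ov: "u v - u w \<le> (1 - p) * R"
            if v: "v \<in> ball m (r / 2)" and w: "w \<in> ball m (r / 2)" and cl: "dist v w \<le> l * \<epsilon> / 2"
              and R: "\<And>x' z'. dist v x' < L * \<epsilon> \<Longrightarrow> dist w z' < L * \<epsilon> \<Longrightarrow> u x' - u z' \<le> R" and R0: "0 \<le> R" for v w R
            using overlap_estimate[OF S[OF half[OF v]] S[OF half[OF w]] l \<epsilon> detS[OF half[OF v] half[OF w]] E E
                intE[OF half[OF v]] intE[OF half[OF w]] cl R R0]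
              uE[OF half[OF v]] uE[OF half[OF w]] unfolding p_def by simp
          have main: "u v - u w \<le> C0 * \<epsilon> powr \<alpha> * (K + profile s b ((dist v w / \<epsilon>) powr \<alpha>)) + a * ((dist v m)\<^sup>2 + (dist w m)\<^sup>2)"
            if "v \<in> ball m r" "w \<in> ball m r" for v w
            by (rule comparison[where S="?S" and p=p and B=B, OF l \<alpha> sb c contraction r \<epsilon> L\<epsilon> _ S[OF half] avg ov p K_def a C0 C01 C02 that])
               (use bound msub in auto)
          have bound': "C0 * \<epsilon> powr \<alpha> * (K + profile s b ((t / \<epsilon>) powr \<alpha>)) + a * ((t / 2)\<^sup>2 + (t / 2)\<^sup>2)
              \<le> C * (t powr \<alpha> + \<epsilon> powr \<alpha>)"
          proof -
            have "profile s b ((t / \<epsilon>) powr \<alpha>) \<le> (t / \<epsilon>) powr \<alpha>" using sb by (simp add: profile_def)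
            then have "C0 * \<epsilon> powr \<alpha> * (K + profile s b ((t / \<epsilon>) powr \<alpha>)) \<le> C0 * \<epsilon> powr \<alpha> * (K + (t / \<epsilon>) powr \<alpha>)"
              using C0 by (intro mult_left_mono) auto
            also have "\<dots> = C0 * K * \<epsilon> powr \<alpha> + C0 * t powr \<alpha>"
              using \<epsilon> t by (simp add: powr_divide distrib_left)
            finally have 1: "C0 * \<epsilon> powr \<alpha> * (K + profile s b ((t / \<epsilon>) powr \<alpha>)) \<le> C0 * K * \<epsilon> powr \<alpha> + C0 * t powr \<alpha>" .
            have "t\<^sup>2 \<le> r powr (2 - \<alpha>) * t powr \<alpha>"
              using powr_le_smaller_exponent[of t r \<alpha> 2] t 3 \<alpha> by simp
            then have "a * t\<^sup>2 \<le> a * (r powr (2 - \<alpha>) * t powr \<alpha>)" using a by (intro mult_left_mono) auto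
            moreover have "(t / 2)\<^sup>2 + (t / 2)\<^sup>2 \<le> t\<^sup>2" by (simp add: power2_eq_square)
            then have "a * ((t / 2)\<^sup>2 + (t / 2)\<^sup>2) \<le> a * t\<^sup>2" using a by (intro mult_left_mono) auto
            moreover have "C0 * K * \<epsilon> powr \<alpha> \<le> C * \<epsilon> powr \<alpha>" using Cge by (intro mult_right_mono) auto
            moreover have "(C0 + a * r powr (2 - \<alpha>)) * t powr \<alpha> \<le> C * t powr \<alpha>" using Cge by (intro mult_right_mono) auto
            ultimately show ?thesis using 1 by (simp add: algebra_simps)
          qed
          have "u x - u z \<le> C * (t powr \<alpha> + \<epsilon> powr \<alpha>)" "u z - u x \<le> C * (t powr \<alpha> + \<epsilon> powr \<alpha>)"
            using main[OF xm] main[OF xm(2,1)] bound' unfolding dm by (simp_all add: t_def dist_commute)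
          then show ?thesis unfolding t_def by linarith
        qed
      qed
    qed
  qed
qed

end
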